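(* Let $0<\delta_0<1$ and $0<\delta<\sqrt{\delta_0/(2-\delta_0)}$. For $0<t<1$ let $\rho_n$ be the density of eigenvalues for the potential $V(z)=|z|^2-\mathrm{Re}(tz^2)$. Then $$\lim_{n\to\infty}\sup_{0<t<1-\delta_0}\sup_{z\in E_{t,-,\delta}}\left|\rho_n(z)-\tfrac1\pi\right|=0,$$ $$\lim_{n\to\infty}\sup_{0<t<1-\delta_0}\sup_{z\in\mathbb C\setminus E_{t,+,\delta}}\left|\rho_n(z)\right|=0,$$ $$\lim_{n\to\infty}\sup_{0<t<1-\delta_0}\sup_{z\in\partial E_t}\left|\rho_n(z)-\tfrac1{2\pi}\right|=0.$$
   Context: For $n\in\mathbb N$ and $0<t<1$, let $V(z)=|z|^2-\mathrm{Re}(tz^2)$ and let $(p_{k,n})_{k\ge0}$ be the polynomials with $\deg p_{k,n}=k$ and positive leading coefficient satisfying $\int_{\mathbb C}\overline{p_{k,n}(z)}p_{l,n}(z)e^{-nV(z)}\,d^2z=\delta_{kl}$ ($d^2z$ is Lebesgue measure). The density of eigenvalues is $\rho_n(z)=\frac1n e^{-nV(z)}\sum_{k=0}^{n-1}|p_{k,n}(z)|^2$. Let $a_t=\sqrt{\frac{1+t}{1-t}}$, $b_t=\sqrt{\frac{1-t}{1+t}}$, $\partial E_t=\{z\in\mathbb C:\frac{(\mathrm{Re}\,z)^2}{a_t^2}+\frac{(\mathrm{Im}\,z)^2}{b_t^2}=1\}$, and for $\delta<b_t$ let $E_{t,\pm,\delta}=\{z\in\mathbb C:\frac{(\mathrm{Re}\,z)^2}{(a_t\pm\delta)^2}+\frac{(\mathrm{Im}\,z)^2}{(b_t\pm\delta)^2}<1\}$.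 *)

theory Defs
  imports "HOL-Analysis.Analysis"
begin

definition elliptic_potential :: "real \<Rightarrow> complex \<Rightarrow> real" where
  "elliptic_potential t z = (cmod z)\<^sup>2 - Re (of_real t * z\<^sup>2)"

(* No separate integrability condition is needed: the Bochner integral of a non-integrable function
   is 0, so the case k = l forces every p k to be square-integrable against exp (- n V), and the
   mixed products are then integrable by Cauchy-Schwarz. *)
definition is_orthonormal_polys ::
    "(complex \<Rightarrow> real) \<Rightarrow> nat \<Rightarrow> (nat \<Rightarrow> complex poly) \<Rightarrow> bool" where
  "is_orthonormal_polys V n p \<longleftrightarrow>
     (\<forall>k. degree (p k) = k \<and> lead_coeff (p k) \<in> \<real> \<and> Re (lead_coeff (p k)) > 0) \<and>
     (\<forall>k l. (LINT z|lborel. cnj (poly (p k) z) * poly (p l) z * of_real (exp (- real n * V z)))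
              = (if k = l then 1 else 0))"

definition orthonormal_polys :: "(complex \<Rightarrow> real) \<Rightarrow> nat \<Rightarrow> nat \<Rightarrow> complex poly" where
  "orthonormal_polys V n = (THE p. is_orthonormal_polys V n p)"

definition eigenvalue_density :: "(complex \<Rightarrow> real) \<Rightarrow> nat \<Rightarrow> complex \<Rightarrow> real" where
  "eigenvalue_density V n z =
     1 / real n * exp (- real n * V z) * (\<Sum>k<n. (cmod (poly (orthonormal_polys V n k) z))\<^sup>2)"

definition semi_major :: "real \<Rightarrow> real" where
  "semi_major t = sqrt ((1 + t) / (1 - t))"

definition semi_minor :: "real \<Rightarrow> real" where
  "semi_minor t = sqrt ((1 - t) / (1 + t))"

definition ellipse_boundary :: "real \<Rightarrow> complex set" where
  "ellipse_boundary t = {z. (Re z)\<^sup>2 / (semi_major t)\<^sup>2 + (Im z)\<^sup>2 / (semi_minor t)\<^sup>2 = 1}"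

definition ellipse_plus :: "real \<Rightarrow> real \<Rightarrow> complex set" where
  "ellipse_plus t \<delta> =
     {z. (Re z)\<^sup>2 / (semi_major t + \<delta>)\<^sup>2 + (Im z)\<^sup>2 / (semi_minor t + \<delta>)\<^sup>2 < 1}"

(* Only meaningful for \<delta> < semi_minor t. *)
definition ellipse_minus :: "real \<Rightarrow> real \<Rightarrow> complex set" where
  "ellipse_minus t \<delta> =
     {z. (Re z)\<^sup>2 / (semi_major t - \<delta>)\<^sup>2 + (Im z)\<^sup>2 / (semi_minor t - \<delta>)\<^sup>2 < 1}"

end

theory Submission
  imports Defs "HOL-Probability.Probability" "HOL-Complex_Analysis.Complex_Analysis"
begin

text \<open>
  The orthonormal polynomials are rescaled Hermite polynomials \<open>H k\<close>, so that
  \<open>\<pi> \<rho>\<^sub>n(z) = (\<Sum>k<n. A k)\<close> with \<open>A k = sqrt (1 - t\<^sup>2) exp (- n V z) |H k z|\<^sup>2 / k!\<close>.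
  By Mehler's formula the weights \<open>A k\<close> form a probability distribution on the naturals
  whose generating function is
  \<open>sqrt ((1 - t\<^sup>2) / (1 - t\<^sup>2 u\<^sup>2)) exp (n (u - 1) (X (1 + t) / (1 + t u) + Y (1 - t) / (1 - t u)))\<close>,
  where \<open>X = (Re z)\<^sup>2 / a\<^sub>t\<^sup>2\<close> and \<open>Y = (Im z)\<^sup>2 / b\<^sub>t\<^sup>2\<close>. Thus \<open>\<pi> \<rho>\<^sub>n(z)\<close> is the probability
  that a random variable with mean \<open>n (X + Y) + O(1)\<close> and variance of order \<open>n\<close> is less than \<open>n\<close>.
  Inside and outside the ellipse \<open>X + Y = 1\<close> a Chernoff bound gives \<open>1\<close> and \<open>0\<close> exponentially
  fast; on the ellipse the central limit theorem gives \<open>1/2\<close>.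
\<close>

section \<open>Rescaled Hermite polynomials\<close>

text \<open>Uniformity in \<open>t\<close> rests on the singularities \<open>u = 1 / t\<close> and
  \<open>u = - 1 / t\<close> of the generating function, which stay outside the unit circle at a
  distance controlled by \<open>\<delta>\<^sub>0\<close>. This leaves room for a real
  \<open>u\<close> slightly above 1 in the Chernoff bound, and keeps \<open>1 + t u\<close> and
  \<open>1 - t u\<close> away from zero on the unit circle, where the generating function yields the
  characteristic function. The random variable is not given as a sum of independent terms, so the
  central limit theorem is reached through characteristic functions and Levy continuity. That
  argument yields no rate; uniformity on the ellipse is obtained by letting \<open>t\<close> and
  \<open>z\<close> vary with \<open>n\<close>.

  With He_k the Hermite polynomials for the weight exp(-x^2/2),
  \<open>scaled_hermite \<gamma> t k\<close> is t^(k/2) He_k(\<gamma> z / sqrt t). Absorbing the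
  power of \<open>t\<close> into the recurrence avoids roots of \<open>t\<close>, and
  \<open>t = 0\<close> gives the powers of \<gamma> z.\<close>

fun scaled_hermite :: "real \<Rightarrow> real \<Rightarrow> nat \<Rightarrow> complex poly" where
  "scaled_hermite \<gamma> t 0 = 1"
| "scaled_hermite \<gamma> t (Suc 0) = [:0, of_real \<gamma>:]"
| "scaled_hermite \<gamma> t (Suc (Suc k)) =
     [:0, of_real \<gamma>:] * scaled_hermite \<gamma> t (Suc k)
     - smult (of_real (t * real (Suc k))) (scaled_hermite \<gamma> t k)"

text \<open>One formula for both recursive equations: at \<open>k = 0\<close> the truncated index
  \<open>k - 1\<close> is multiplied by zero. Mehler's formula below takes the recurrence in this
  shape.\<close>

lemma scaled_hermite_Suc:
  "scaled_hermite \<gamma> t (Suc k) =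
     [:0, of_real \<gamma>:] * scaled_hermite \<gamma> t k
     - smult (of_real (t * real k)) (scaled_hermite \<gamma> t (k - 1))"
  by (cases k) auto

lemma poly_scaled_hermite_Suc:
  "poly (scaled_hermite \<gamma> t (Suc k)) z =
     of_real \<gamma> * z * poly (scaled_hermite \<gamma> t k) z
     - of_real (t * real k) * poly (scaled_hermite \<gamma> t (k - 1)) z"
  by (subst scaled_hermite_Suc) (simp add: algebra_simps)

text \<open>The Appell property. It rewrites the recurrence as H (k+1) = \<gamma> z H k - (t /
  \<gamma>) (H k)', the form to which integration by parts applies.\<close>

lemma pderiv_scaled_hermite:
  "pderiv (scaled_hermite \<gamma> t k) = smult (of_real (\<gamma> * real k)) (scaled_hermite \<gamma> t (k - 1))"
proof (induction \<gamma> t k rule: scaled_hermite.induct)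
  case (3 \<gamma> t k)
  have "poly (pderiv (scaled_hermite \<gamma> t (Suc (Suc k)))) z =
        poly (smult (of_real (\<gamma> * real (Suc (Suc k)))) (scaled_hermite \<gamma> t (Suc (Suc k) - 1))) z" for z
    by (simp add: 3 pderiv_diff pderiv_mult pderiv_smult pderiv_pCons poly_scaled_hermite_Suc
        del: scaled_hermite.simps(2)) (simp add: 3 algebra_simps poly_scaled_hermite_Suc)
  then show ?case by (simp only: poly_eq_poly_eq_iff[symmetric]) auto
qed (auto simp: pderiv_pCons)

lemma degree_scaled_hermite_le: "degree (scaled_hermite \<gamma> t k) \<le> k"
  and coeff_scaled_hermite: "coeff (scaled_hermite \<gamma> t k) k = of_real \<gamma> ^ k"
proof -
  have "degree (scaled_hermite \<gamma> t k) \<le> k \<and> coeff (scaled_hermite \<gamma> t k) k = of_real \<gamma> ^ k"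
  proof (induction \<gamma> t k rule: scaled_hermite.induct)
    case (3 \<gamma> t k)
    have "coeff (scaled_hermite \<gamma> t k) (Suc (Suc k)) = 0"
      using 3 by (intro coeff_eq_0) auto
    then show ?case using 3
      by (auto intro!: degree_diff_le order_trans[OF degree_smult_le]
               order_trans[OF degree_mult_le] order_trans[OF degree_pCons_le])
  qed auto
  then show "degree (scaled_hermite \<gamma> t k) \<le> k" "coeff (scaled_hermite \<gamma> t k) k = of_real \<gamma> ^ k"
    by auto
qed

lemma degree_scaled_hermite: "\<gamma> \<noteq> 0 \<Longrightarrow> degree (scaled_hermite \<gamma> t k) = k"
  by (intro antisym degree_scaled_hermite_le le_degree) (simp add: coeff_scaled_hermite)

lemma cnj_poly_scaled_hermite:
  "cnj (poly (scaled_hermite \<gamma> t k) z) = poly (scaled_hermite \<gamma> t k) (cnj z)"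
  by (induction \<gamma> t k rule: scaled_hermite.induct) auto

section \<open>Gaussian integrals over the complex plane\<close>

lemma lborel_distr_PiM:
  "(lborel :: 'a::euclidean_space measure) =
     distr (\<Pi>\<^sub>M b\<in>Basis. lborel) borel (\<lambda>f. \<Sum>b\<in>Basis. f b *\<^sub>R b)"
  by (simp add: lborel_def[where 'a='a] lborel_eq_real)

lemma has_bochner_integral_lborel_complex_prod:
  fixes f g :: "real \<Rightarrow> complex"
  assumes f: "has_bochner_integral lborel f I" and g: "has_bochner_integral lborel g J"
  shows "has_bochner_integral lborel (\<lambda>z. f (Re z) * g (Im z)) (I * J)"
proof -
  interpret product_sigma_finite "\<lambda>_::complex. lborel :: real measure"
    by standard
  \<comment> \<open>The product over \<open>Basis\<close> has one factor per coordinate: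
    \<open>f\<close> along 1 and \<open>g\<close> along \<open>\<i>\<close>.\<close>
  define h where "h = (\<lambda>b::complex. if b = 1 then f else g)"
  have B: "(Basis :: complex set) = {1, \<i>}" by (simp add: Basis_complex_def)
  have ne: "(1::complex) \<noteq> \<i>" by (simp add: complex_eq_iff)
  have [measurable]: "f \<in> borel_measurable borel" "g \<in> borel_measurable borel"
    using f g by (auto dest!: borel_measurable_has_bochner_integral)
  have int: "integrable lborel (h b)" for b
    using f g by (auto simp: h_def has_bochner_integral_iff)
  have eq: "(\<Prod>b\<in>Basis. h b (x b)) =
      f (Re (\<Sum>b\<in>Basis. x b *\<^sub>R b)) * g (Im (\<Sum>b\<in>Basis. x b *\<^sub>R b))" for x
    unfolding B using ne ne[symmetric] by (simp add: h_def)
  have 1: "integrable (\<Pi>\<^sub>M b\<in>Basis. lborel) (\<lambda>x. \<Prod>b\<in>(Basis::complex set). h b (x b))"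
    by (intro product_integrable_prod int) auto
  have 2: "(\<integral>x. (\<Prod>b\<in>(Basis::complex set). h b (x b)) \<partial>(\<Pi>\<^sub>M b\<in>Basis. lborel)) = I * J"
    by (subst product_integral_prod) (use int f g ne ne[symmetric] in \<open>auto simp: B h_def has_bochner_integral_iff\<close>)
  show ?thesis
    by (subst lborel_distr_PiM, rule has_bochner_integral_distr)
       (use 1 2 in \<open>simp_all add: has_bochner_integral_iff eq\<close>)
qed

definition gauss_moment :: "real \<Rightarrow> nat \<Rightarrow> real" where
  "gauss_moment \<alpha> k = (LINT x|lborel. x ^ k * exp (- \<alpha> * x\<^sup>2))"

context
  fixes \<alpha> :: real
  assumes \<alpha>: "\<alpha> > 0"
begin

lemma gauss_density_eq:
  "exp (- \<alpha> * x\<^sup>2) = sqrt (pi / \<alpha>) * normal_density 0 (1 / sqrt (2 * \<alpha>)) x"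
proof -
  have "(1 / sqrt (2 * \<alpha>))\<^sup>2 = 1 / (2 * \<alpha>)"
    using \<alpha> by (simp add: power_divide)
  then show ?thesis
    using \<alpha> by (simp add: normal_density_def real_sqrt_divide field_simps)
qed

lemma gauss_moment_even:
  "has_bochner_integral lborel (\<lambda>x. x ^ (2 * k) * exp (- \<alpha> * x\<^sup>2))
     (sqrt (pi / \<alpha>) * (fact (2 * k) / ((4 * \<alpha>) ^ k * fact k)))"
proof -
  have s: "2 / (1 / sqrt (2 * \<alpha>))\<^sup>2 = 4 * \<alpha>"
    using \<alpha> by (simp add: power_divide)
  show ?thesis
    using has_bochner_integral_mult_right[OF
        normal_moment_even[where \<mu> = 0 and \<sigma> = "1 / sqrt (2 * \<alpha>)" and k = k, unfolded s], of "sqrt (pi / \<alpha>)"] \<alpha>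
    unfolding gauss_density_eq by (simp add: mult_ac)
qed

lemma gauss_moment_odd:
  "has_bochner_integral lborel (\<lambda>x. x ^ (2 * k + 1) * exp (- \<alpha> * x\<^sup>2)) 0"
  using has_bochner_integral_mult_right[OF
      normal_moment_odd[where \<mu> = 0 and \<sigma> = "1 / sqrt (2 * \<alpha>)" and k = k], of "sqrt (pi / \<alpha>)"] \<alpha>
  unfolding gauss_density_eq by (simp add: mult_ac)

lemma has_bochner_integral_gauss_moment:
  "has_bochner_integral lborel (\<lambda>x. x ^ k * exp (- \<alpha> * x\<^sup>2)) (gauss_moment \<alpha> k)"
proof -
  have "\<exists>I. has_bochner_integral lborel (\<lambda>x. x ^ k * exp (- \<alpha> * x\<^sup>2)) I"
  proof (cases "even k")
    case True
    then obtain j where "k = 2 * j" by (elim evenE)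
    then show ?thesis using gauss_moment_even[of j] by blast
  next
    case False
    then obtain j where "k = 2 * j + 1" by (elim oddE)
    then show ?thesis using gauss_moment_odd[of j] by blast
  qed
  then show ?thesis
    unfolding gauss_moment_def using has_bochner_integral_integral_eq by metis
qed

lemma gauss_moment_0: "gauss_moment \<alpha> 0 = sqrt (pi / \<alpha>)"
  using has_bochner_integral_integral_eq[OF gauss_moment_even[of 0]]
  by (simp add: gauss_moment_def)

text \<open>Integration by parts in one variable, read off from the explicit moments, so that no
  boundary terms appear. At \<open>k = 0\<close> the truncated index is again multiplied by
  zero.\<close>

lemma gauss_moment_Suc: "gauss_moment \<alpha> (Suc k) = real k / (2 * \<alpha>) * gauss_moment \<alpha> (k - 1)"
proof (cases "even k")
  case True
  then obtain j where k: "k = 2 * j" by (elim evenE)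
  have "gauss_moment \<alpha> (2 * j + 1) = 0"
    unfolding gauss_moment_def by (rule has_bochner_integral_integral_eq[OF gauss_moment_odd])
  moreover have "j > 0 \<Longrightarrow> gauss_moment \<alpha> (2 * (j - 1) + 1) = 0"
    unfolding gauss_moment_def by (rule has_bochner_integral_integral_eq[OF gauss_moment_odd])
  moreover have "j > 0 \<Longrightarrow> 2 * (j - 1) + 1 = k - 1" using k by simp
  ultimately show ?thesis using k by (cases "j = 0") auto
next
  case False
  then obtain j where k: "k = 2 * j + 1" by (elim oddE)
  have e: "gauss_moment \<alpha> (2 * j) = sqrt (pi / \<alpha>) * (fact (2 * j) / ((4 * \<alpha>) ^ j * fact j))" for j
    unfolding gauss_moment_def by (rule has_bochner_integral_integral_eq[OF gauss_moment_even])
  have "Suc k = 2 * Suc j" "k - 1 = 2 * j" using k by auto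
  moreover define A :: real where "A = fact (2 * j) / ((4 * \<alpha>) ^ j * fact j)"
  have "fact (2 * Suc j) / ((4 * \<alpha>) ^ Suc j * fact (Suc j)) = real (2 * j + 1) / (2 * \<alpha>) * A"
    using \<alpha> by (simp add: A_def divide_simps)
  ultimately show ?thesis using e[of j] e[of "Suc j"] k
    by (simp add: A_def)
qed

end

text \<open>The polynomials in \<open>Re z\<close> and \<open>Im z\<close>, equivalently in
  \<open>z\<close> and \<open>cnj z\<close>. Unlike the polynomials in \<open>z\<close> they are
  closed under conjugation, hence contain the integrands of the inner product; generation by
  monomials reduces linear claims to products of Gaussian moments.\<close>

inductive bipoly :: "(complex \<Rightarrow> complex) \<Rightarrow> bool" where
  mono: "bipoly (\<lambda>z. c * of_real (Re z ^ i * Im z ^ j))"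
| add: "bipoly F \<Longrightarrow> bipoly G \<Longrightarrow> bipoly (\<lambda>z. F z + G z)"

lemma bipoly_const: "bipoly (\<lambda>z. c)"
  using bipoly.mono[of c 0 0] by simp

lemma bipoly_id: "bipoly (\<lambda>z. z)"
proof -
  have "(\<lambda>z. 1 * of_real (Re z ^ 1 * Im z ^ 0) + \<i> * of_real (Re z ^ 0 * Im z ^ 1)) = (\<lambda>z::complex. z)"
    by (rule ext) (simp add: complex_eq_iff)
  with bipoly.add[OF bipoly.mono[of 1 1 0] bipoly.mono[of \<i> 0 1]] show ?thesis
    by (rule back_subst[of bipoly])
qed

lemma bipoly_cnj: "bipoly F \<Longrightarrow> bipoly (\<lambda>z. cnj (F z))"
proof (induction rule: bipoly.induct)
  case (mono c i j)
  show ?case using bipoly.mono[of "cnj c" i j] by simp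
next
  case (add F G)
  then show ?case using bipoly.add[OF add(3,4)] by simp
qed

lemma bipoly_mult:
  assumes "bipoly F" "bipoly G"
  shows "bipoly (\<lambda>z. F z * G z)"
  using assms(1)
proof (induction rule: bipoly.induct)
  case (mono c i j)
  from assms(2) show ?case
  proof (induction rule: bipoly.induct)
    case (mono c' i' j')
    show ?case using bipoly.mono[of "c * c'" "i + i'" "j + j'"] by (simp add: power_add mult_ac)
  next
    case (add F G)
    then show ?case using bipoly.add[OF add(3,4)] by (simp add: algebra_simps)
  qed
next
  case (add F G)
  then show ?case using bipoly.add[OF add(3,4)] by (simp add: algebra_simps)
qed

lemma bipoly_poly: "bipoly (poly p)"
proof (induction p)
  case 0
  then show ?case using bipoly_const[of 0] by simp
next
  case (pCons a p)
  have "bipoly (\<lambda>z. a + z * poly p z)"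
    by (intro bipoly.add bipoly_const bipoly_mult bipoly_id pCons)
  then show ?case by simp
qed

lemma has_bochner_integral_bipoly_mono:
  fixes c :: complex
  assumes "\<alpha> > 0" "\<beta> > 0"
  shows "has_bochner_integral lborel
    (\<lambda>z. c * of_real (Re z ^ i * Im z ^ j) * of_real (exp (- \<alpha> * (Re z)\<^sup>2) * exp (- \<beta> * (Im z)\<^sup>2)))
    (c * of_real (gauss_moment \<alpha> i * gauss_moment \<beta> j))"
proof -
  have "has_bochner_integral lborel
    (\<lambda>z. c * (of_real (Re z ^ i * exp (- \<alpha> * (Re z)\<^sup>2)) * of_real (Im z ^ j * exp (- \<beta> * (Im z)\<^sup>2))))
    (c * (of_real (gauss_moment \<alpha> i) * of_real (gauss_moment \<beta> j)))"
    by (intro has_bochner_integral_mult_right has_bochner_integral_lborel_complex_prod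
        has_bochner_integral_of_real has_bochner_integral_gauss_moment assms)
  then show ?thesis by (simp add: mult_ac)
qed

lemma integrable_bipoly:
  assumes "\<alpha> > 0" "\<beta> > 0" "bipoly F"
  shows "integrable lborel (\<lambda>z. F z * of_real (exp (- \<alpha> * (Re z)\<^sup>2) * exp (- \<beta> * (Im z)\<^sup>2)))"
  using assms(3)
proof (induction rule: bipoly.induct)
  case (mono c i j)
  show ?case using has_bochner_integral_bipoly_mono[OF assms(1,2), of c i j]
    by (auto simp only: has_bochner_integral_iff)
next
  case (add F G)
  then show ?case by (simp only: distrib_right) auto
qed

text \<open>A relation, so that the derivatives which an induction over monomials produces and those
  which the product rule produces can be compared by uniqueness.\<close>

definition partials ::
    "(complex \<Rightarrow> complex) \<Rightarrow> (complex \<Rightarrow> complex) \<Rightarrow> (complex \<Rightarrow> complex) \<Rightarrow> bool" where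
  "partials F DX DY \<longleftrightarrow>
    (\<forall>z. ((\<lambda>s. F (z + of_real s)) has_vector_derivative DX z) (at 0)) \<and>
    (\<forall>z. ((\<lambda>s. F (z + \<i> * of_real s)) has_vector_derivative DY z) (at 0))"

lemma partials_unique:
  assumes "partials F DX DY" "partials F DX' DY'"
  shows "DX = DX'" "DY = DY'"
  using assms unfolding partials_def by (auto intro!: ext vector_derivative_unique_at)

lemma partials_add:
  assumes "partials F DX DY" "partials G DX' DY'"
  shows "partials (\<lambda>z. F z + G z) (\<lambda>z. DX z + DX' z) (\<lambda>z. DY z + DY' z)"
  using assms unfolding partials_def by (auto intro!: has_vector_derivative_add)

text \<open>The derivatives are quantified existentially because for a sum the induction has to
  supply those of the summands. On monomials the claim is \<open>gauss_moment_Suc\<close> in one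
  coordinate. Uniqueness of the derivatives then transfers the result to any given ones.\<close>

lemma bipoly_integration_by_parts_ex:
  assumes "\<alpha> > 0" "\<beta> > 0" "bipoly F"
  defines "E \<equiv> \<lambda>F. (LINT z|lborel. F z * of_real (exp (- \<alpha> * (Re z)\<^sup>2) * exp (- \<beta> * (Im z)\<^sup>2)))"
  defines "S \<equiv> \<lambda>F DX DY. bipoly DX \<and> bipoly DY \<and>
    partials F DX DY \<and>
    E (\<lambda>z. of_real (Re z) * F z) = of_real (1 / (2 * \<alpha>)) * E DX \<and>
    E (\<lambda>z. of_real (Im z) * F z) = of_real (1 / (2 * \<beta>)) * E DY"
  shows "\<exists>DX DY. S F DX DY"
  using assms(3)
proof (induction rule: bipoly.induct)
  case (mono c i j)
  have Emono: "E (\<lambda>z. c * of_real (Re z ^ i * Im z ^ j)) = c * of_real (gauss_moment \<alpha> i * gauss_moment \<beta> j)"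
    for c i j
    unfolding E_def by (rule has_bochner_integral_integral_eq[OF has_bochner_integral_bipoly_mono[OF assms(1,2)]])
  let ?DX = "\<lambda>z. (c * of_nat i) * of_real (Re z ^ (i - 1) * Im z ^ j)"
  let ?DY = "\<lambda>z. (c * of_nat j) * of_real (Re z ^ i * Im z ^ (j - 1))"
  have "((\<lambda>s. c * of_real (Re (z + of_real s) ^ i * Im (z + of_real s) ^ j)) has_vector_derivative ?DX z) (at 0)" for z
  proof -
    have "((\<lambda>s. (Re z + s) ^ i * Im z ^ j) has_real_derivative real i * Re z ^ (i - 1) * Im z ^ j) (at 0)"
      by (auto intro!: derivative_eq_intros)
    from has_vector_derivative_mult_right[OF has_vector_derivative_of_real[OF this], of c]
    show ?thesis by (simp add: mult_ac)
  qed
  moreover have "((\<lambda>s. c * of_real (Re (z + \<i> * of_real s) ^ i * Im (z + \<i> * of_real s) ^ j)) has_vector_derivative ?DY z) (at 0)" for z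
  proof -
    have "((\<lambda>s. Re z ^ i * (Im z + s) ^ j) has_real_derivative real j * Re z ^ i * Im z ^ (j - 1)) (at 0)"
      by (auto intro!: derivative_eq_intros)
    from has_vector_derivative_mult_right[OF has_vector_derivative_of_real[OF this], of c]
    show ?thesis by (simp add: mult_ac)
  qed
  moreover have "E (\<lambda>z. of_real (Re z) * (c * of_real (Re z ^ i * Im z ^ j))) = of_real (1 / (2 * \<alpha>)) * E ?DX"
    using Emono[of c "Suc i" j] Emono[of "c * of_nat i" "i - 1" j] gauss_moment_Suc[OF assms(1), of i]
    by (simp add: mult_ac)
  moreover have "E (\<lambda>z. of_real (Im z) * (c * of_real (Re z ^ i * Im z ^ j))) = of_real (1 / (2 * \<beta>)) * E ?DY"
    using Emono[of c i "Suc j"] Emono[of "c * of_nat j" i "j - 1"] gauss_moment_Suc[OF assms(2), of j]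
    by (simp add: mult_ac)
  moreover have "bipoly ?DX" "bipoly ?DY" by (rule bipoly.mono)+
  ultimately have "S (\<lambda>z. c * of_real (Re z ^ i * Im z ^ j)) ?DX ?DY"
    unfolding S_def partials_def by (intro conjI allI)
  then show ?case by (intro exI)
next
  case (add F G)
  have Eadd: "E (\<lambda>z. F z + G z) = E F + E G" if "bipoly F" "bipoly G" for F G
    unfolding E_def distrib_right
    by (intro Bochner_Integration.integral_add integrable_bipoly assms that)
  have re: "bipoly (\<lambda>z. of_real (Re z) * F z)" and im: "bipoly (\<lambda>z. of_real (Im z) * F z)"
    if "bipoly F" for F
    using bipoly_mult[OF bipoly.mono[of 1 1 0] that] bipoly_mult[OF bipoly.mono[of 1 0 1] that] by simp_all
  from add(3) obtain DX DY where "S F DX DY" by (elim exE)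
  then have d: "bipoly DX" "bipoly DY"
    "partials F DX DY"
    "E (\<lambda>z. of_real (Re z) * F z) = of_real (1 / (2 * \<alpha>)) * E DX"
    "E (\<lambda>z. of_real (Im z) * F z) = of_real (1 / (2 * \<beta>)) * E DY"
    unfolding S_def by auto
  from add(4) obtain DX' DY' where "S G DX' DY'" by (elim exE)
  then have d': "bipoly DX'" "bipoly DY'"
    "partials G DX' DY'"
    "E (\<lambda>z. of_real (Re z) * G z) = of_real (1 / (2 * \<alpha>)) * E DX'"
    "E (\<lambda>z. of_real (Im z) * G z) = of_real (1 / (2 * \<beta>)) * E DY'"
    unfolding S_def by auto
  have "S (\<lambda>z. F z + G z) (\<lambda>z. DX z + DX' z) (\<lambda>z. DY z + DY' z)"
    unfolding S_def
  proof (intro conjI allI bipoly.add partials_add d d')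
    show "E (\<lambda>z. of_real (Re z) * (F z + G z)) = of_real (1 / (2 * \<alpha>)) * E (\<lambda>z. DX z + DX' z)"
      unfolding Eadd[OF d(1) d'(1)] distrib_left Eadd[OF re[OF add(1)] re[OF add(2)]] d d' ..
    show "E (\<lambda>z. of_real (Im z) * (F z + G z)) = of_real (1 / (2 * \<beta>)) * E (\<lambda>z. DY z + DY' z)"
      unfolding Eadd[OF d(2) d'(2)] distrib_left Eadd[OF im[OF add(1)] im[OF add(2)]] d d' ..
  qed
  then show ?case by (intro exI)
qed

lemma bipoly_integration_by_parts:
  assumes "\<alpha> > 0" "\<beta> > 0" "bipoly F"
    and "partials F DX DY"
  defines "E \<equiv> \<lambda>F. (LINT z|lborel. F z * of_real (exp (- \<alpha> * (Re z)\<^sup>2) * exp (- \<beta> * (Im z)\<^sup>2)))"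
  shows "E (\<lambda>z. of_real (Re z) * F z) = of_real (1 / (2 * \<alpha>)) * E DX"
    and "E (\<lambda>z. of_real (Im z) * F z) = of_real (1 / (2 * \<beta>)) * E DY"
proof -
  obtain DX' DY' where D: "partials F DX' DY'"
    and *: "E (\<lambda>z. of_real (Re z) * F z) = of_real (1 / (2 * \<alpha>)) * E DX'"
    "E (\<lambda>z. of_real (Im z) * F z) = of_real (1 / (2 * \<beta>)) * E DY'"
    using bipoly_integration_by_parts_ex[OF assms(1-3)] unfolding E_def by auto
  with partials_unique[OF D assms(4)]
  show "E (\<lambda>z. of_real (Re z) * F z) = of_real (1 / (2 * \<alpha>)) * E DX"
    "E (\<lambda>z. of_real (Im z) * F z) = of_real (1 / (2 * \<beta>)) * E DY" by simp_all
qed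

section \<open>Orthonormality\<close>

lemma exp_elliptic_potential:
  "exp (- n * elliptic_potential t z) =
     exp (- (n * (1 - t)) * (Re z)\<^sup>2) * exp (- (n * (1 + t)) * (Im z)\<^sup>2)"
proof -
  have V: "elliptic_potential t z = (1 - t) * (Re z)\<^sup>2 + (1 + t) * (Im z)\<^sup>2"
    unfolding elliptic_potential_def cmod_power2 by (simp add: power2_eq_square algebra_simps)
  show ?thesis unfolding exp_add[symmetric] V by (simp add: algebra_simps)
qed

definition poly_ip :: "real \<Rightarrow> real \<Rightarrow> complex poly \<Rightarrow> complex poly \<Rightarrow> complex" where
  "poly_ip n t f g =
     (LINT z|lborel. cnj (poly f z) * poly g z * of_real (exp (- n * elliptic_potential t z)))"

lemma cnj_poly_ip: "cnj (poly_ip n t f g) = poly_ip n t g f"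
  unfolding poly_ip_def
  by (subst Bochner_Integration.integral_cnj[symmetric], intro Bochner_Integration.integral_cong) (auto simp: mult_ac)

lemma has_vector_derivative_poly:
  fixes p :: "complex poly"
  assumes "(h has_vector_derivative d) (at x)"
  shows "((\<lambda>s. poly p (h s)) has_vector_derivative poly (pderiv p) (h x) * d) (at x)"
  using field_vector_diff_chain_at[OF assms poly_DERIV] by (simp add: o_def mult.commute)

context
  fixes n t :: real
  assumes n: "n > 0" and t: "\<bar>t\<bar> < 1"
begin

lemma integrable_poly_ip:
  "integrable lborel (\<lambda>z. cnj (poly f z) * poly g z * of_real (exp (- n * elliptic_potential t z)))"
  unfolding exp_elliptic_potential using n t
  by (intro integrable_bipoly bipoly_mult bipoly_cnj bipoly_poly) auto

lemma poly_ip_add_right: "poly_ip n t f (g + h) = poly_ip n t f g + poly_ip n t f h"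
  unfolding poly_ip_def poly_add distrib_left distrib_right
  by (intro Bochner_Integration.integral_add integrable_poly_ip)

lemma poly_ip_smult_right: "poly_ip n t f (smult c g) = c * poly_ip n t f g"
  unfolding poly_ip_def
  by (subst integral_mult_right_zero[symmetric])
     (auto intro!: Bochner_Integration.integral_cong simp: algebra_simps)

lemma poly_ip_diff_right: "poly_ip n t f (g - h) = poly_ip n t f g - poly_ip n t f h"
  using poly_ip_add_right[of f g "smult (-1) h"] poly_ip_smult_right[of f "-1" h] by simp

lemma poly_ip_diff_left: "poly_ip n t (g - h) f = poly_ip n t g f - poly_ip n t h f"
  using arg_cong[OF poly_ip_diff_right[of f g h], of cnj] by (simp add: cnj_poly_ip)

lemma poly_ip_smult_left: "poly_ip n t (smult c g) f = cnj c * poly_ip n t g f"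
  using arg_cong[OF poly_ip_smult_right[of f c g], of cnj] by (simp add: cnj_poly_ip)

text \<open>Integration by parts with respect to \<open>\<partial>/\<partial>z\<close>, which maps the weight \<open>exp (- n V z)\<close> to
  \<open>- n (cnj z - t z) exp (- n V z)\<close>.\<close>

lemma poly_ip_times_left:
  "of_real n * poly_ip n t ([:0, 1:] * g) f =
     poly_ip n t g (pderiv f) + of_real (n * t) * poly_ip n t g ([:0, 1:] * f)"
proof -
  define E :: "(complex \<Rightarrow> complex) \<Rightarrow> complex" where "E = (\<lambda>F. LINT z|lborel.
    F z * of_real (exp (- (n * (1 - t)) * (Re z)\<^sup>2) * exp (- (n * (1 + t)) * (Im z)\<^sup>2)))"
  define F where "F = (\<lambda>z. cnj (poly g z) * poly f z)"
  define A where "A = (\<lambda>z. cnj (poly (pderiv g) z) * poly f z)"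
  define B where "B = (\<lambda>z. cnj (poly g z) * poly (pderiv f) z)"
  have pos: "n * (1 - t) > 0" "n * (1 + t) > 0" using n t by auto
  have ip: "poly_ip n t f g = E (\<lambda>z. cnj (poly f z) * poly g z)" for f g
    unfolding poly_ip_def E_def exp_elliptic_potential ..
  have bi: "bipoly F" "bipoly A" "bipoly B"
    unfolding F_def A_def B_def by (intro bipoly_mult bipoly_cnj bipoly_poly)+
  have Elin: "E (\<lambda>z. c * P z + d * Q z) = c * E P + d * E Q" if "bipoly P" "bipoly Q" for c d P Q
  proof -
    have add: "E (\<lambda>z. P z + Q z) = E P + E Q" if "bipoly P" "bipoly Q" for P Q
      unfolding E_def distrib_right
      by (intro Bochner_Integration.integral_add integrable_bipoly[OF pos] that)
    have mult: "E (\<lambda>z. c * P z) = c * E P" for c P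
      unfolding E_def mult.assoc by (rule integral_mult_right_zero)
    show ?thesis
      by (subst add) (simp_all add: mult bipoly_mult bipoly_const that)
  qed
  have re: "bipoly (\<lambda>z. of_real (Re z) * F z)" and im: "bipoly (\<lambda>z. of_real (Im z) * F z)"
    using bipoly_mult[OF bipoly.mono[of 1 1 0] bi(1)] bipoly_mult[OF bipoly.mono[of 1 0 1] bi(1)]
    by simp_all
  have dX: "((\<lambda>s. F (z + of_real s)) has_vector_derivative (1 * A z + 1 * B z)) (at 0)" for z
  proof -
    have h: "((\<lambda>s. z + of_real s) has_vector_derivative 1) (at 0)"
      by (auto intro!: derivative_eq_intros)
    show ?thesis unfolding F_def
      by (rule has_vector_derivative_eq_rhs,
          rule has_vector_derivative_mult[OF has_vector_derivative_cnj[OF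
            has_vector_derivative_poly[OF h]] has_vector_derivative_poly[OF h]])
         (simp add: A_def B_def)
  qed
  \<comment> \<open>The conjugated factor contributes the conjugate of \<open>\<i>\<close> times its
    derivative, hence the sign in front of \<open>A\<close>.\<close>
  have dY: "((\<lambda>s. F (z + \<i> * of_real s)) has_vector_derivative ((- \<i>) * A z + \<i> * B z)) (at 0)" for z
  proof -
    have h: "((\<lambda>s. z + \<i> * of_real s) has_vector_derivative \<i>) (at 0)"
      by (auto intro!: derivative_eq_intros)
    show ?thesis unfolding F_def
      by (rule has_vector_derivative_eq_rhs,
          rule has_vector_derivative_mult[OF has_vector_derivative_cnj[OF
            has_vector_derivative_poly[OF h]] has_vector_derivative_poly[OF h]])
         (simp add: A_def B_def)
  qed
  have pa: "partials F (\<lambda>z. 1 * A z + 1 * B z) (\<lambda>z. (- \<i>) * A z + \<i> * B z)"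
    unfolding partials_def using dX dY by blast
  have EX: "E (\<lambda>z. of_real (Re z) * F z) = of_real (1 / (2 * (n * (1 - t)))) * (E A + E B)"
  proof -
    have "E (\<lambda>z. of_real (Re z) * F z) = of_real (1 / (2 * (n * (1 - t)))) * E (\<lambda>z. 1 * A z + 1 * B z)"
      unfolding E_def by (rule bipoly_integration_by_parts(1)[OF pos bi(1) pa])
    then show ?thesis unfolding Elin[OF bi(2,3)] by simp
  qed
  have EY: "E (\<lambda>z. of_real (Im z) * F z) = of_real (1 / (2 * (n * (1 + t)))) * (- \<i> * E A + \<i> * E B)"
  proof -
    have "E (\<lambda>z. of_real (Im z) * F z) = of_real (1 / (2 * (n * (1 + t)))) * E (\<lambda>z. (- \<i>) * A z + \<i> * B z)"
      unfolding E_def by (rule bipoly_integration_by_parts(2)[OF pos bi(1) pa])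
    then show ?thesis unfolding Elin[OF bi(2,3)] .
  qed
  have l: "poly_ip n t ([:0, 1:] * g) f = E (\<lambda>z. of_real (Re z) * F z) - \<i> * E (\<lambda>z. of_real (Im z) * F z)"
  proof -
    have "E (\<lambda>z. 1 * (of_real (Re z) * F z) + (- \<i>) * (of_real (Im z) * F z)) =
        E (\<lambda>z. cnj (poly ([:0, 1:] * g) z) * poly f z)"
      by (rule arg_cong[of _ _ E], rule ext) (simp add: F_def algebra_simps complex_eq_iff)
    then show ?thesis unfolding ip Elin[OF re im] by simp
  qed
  have r: "poly_ip n t g ([:0, 1:] * f) = E (\<lambda>z. of_real (Re z) * F z) + \<i> * E (\<lambda>z. of_real (Im z) * F z)"
  proof -
    have "E (\<lambda>z. 1 * (of_real (Re z) * F z) + \<i> * (of_real (Im z) * F z)) =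
        E (\<lambda>z. cnj (poly g z) * poly ([:0, 1:] * f) z)"
      by (rule arg_cong[of _ _ E], rule ext) (simp add: F_def algebra_simps complex_eq_iff)
    then show ?thesis unfolding ip Elin[OF re im] by simp
  qed
  have b: "poly_ip n t g (pderiv f) = E B" unfolding ip B_def ..
  have c: "complex_of_real n * of_real (1 / (2 * (n * (1 - t)))) * (1 - of_real t) = 1 / 2"
     "complex_of_real n * of_real (1 / (2 * (n * (1 + t)))) * (1 + of_real t) = 1 / 2"
  proof -
    have "n * (1 / (2 * (n * (1 - t)))) * (1 - t) = 1 / 2" "n * (1 / (2 * (n * (1 + t)))) * (1 + t) = 1 / 2"
      using pos n t by (auto simp: divide_simps)
    from this[THEN arg_cong, of complex_of_real]
    show "complex_of_real n * of_real (1 / (2 * (n * (1 - t)))) * (1 - of_real t) = 1 / 2"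
      "complex_of_real n * of_real (1 / (2 * (n * (1 + t)))) * (1 + of_real t) = 1 / 2"
      unfolding of_real_mult of_real_diff of_real_add of_real_1 of_real_divide of_real_numeral .
  qed
  \<comment> \<open>The multiplier \<open>n * (cnj z - t * z)\<close> equals
    \<open>n * (1 - t) * Re z - \<i> * n * (1 + t) * Im z\<close>, so each coordinate cancels its
    own Gaussian constant up to 1/2. The two halves form a Wirtinger derivative: the terms with
    \<open>A\<close>, where the derivative falls on the antiholomorphic factor, cancel.\<close>
  have "of_real n * poly_ip n t ([:0, 1:] * g) f - of_real (n * t) * poly_ip n t g ([:0, 1:] * f) =
     (of_real n * of_real (1 / (2 * (n * (1 - t)))) * (1 - of_real t)) * (E A + E B)
     - \<i> * (of_real n * of_real (1 / (2 * (n * (1 + t)))) * (1 + of_real t)) * (- \<i> * E A + \<i> * E B)"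
  proof -
    have "N * (x * a - \<i> * (y * b)) - N * T * (x * a + \<i> * (y * b)) =
        N * x * (1 - T) * a - \<i> * (N * y * (1 + T)) * b" for N T x y a b :: complex
      by (simp add: algebra_simps)
    then show ?thesis unfolding l r EX EY of_real_mult[of n t] .
  qed
  also have "\<dots> = E B" unfolding c by (simp add: field_simps)
  finally show ?thesis unfolding b by (simp add: algebra_simps)
qed

lemma poly_ip_1_1: "poly_ip n t 1 1 = of_real (pi / (n * sqrt (1 - t\<^sup>2)))"
proof -
  have pos: "n * (1 - t) > 0" "n * (1 + t) > 0" using n t by auto
  have "poly_ip n t 1 1 = of_real (sqrt (pi / (n * (1 - t))) * sqrt (pi / (n * (1 + t))))"
    using has_bochner_integral_integral_eq[OF has_bochner_integral_bipoly_mono[OF pos, of 1 0 0]]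
    unfolding poly_ip_def exp_elliptic_potential gauss_moment_0[OF pos(1)] gauss_moment_0[OF pos(2)]
    by simp
  also have "sqrt (pi / (n * (1 - t))) * sqrt (pi / (n * (1 + t))) = sqrt ((pi / n)\<^sup>2 / (1 - t\<^sup>2))"
    by (simp add: real_sqrt_mult[symmetric] power2_eq_square algebra_simps)
  also have "\<dots> = pi / (n * sqrt (1 - t\<^sup>2))"
    using n by (simp add: real_sqrt_divide)
  finally show ?thesis .
qed

text \<open>The raising operator f -> \<gamma> z f - (t / \<gamma>) f' is adjoint to differentiation
  divided by \<gamma>. The identity \<open>poly_ip_times_left\<close> and its conjugate are two
  linear relations between \<open>A\<close>, \<open>B\<close>, \<open>C\<close>, \<open>D\<close>.
  Eliminating \<open>C\<close> leaves n (1 - t^2) A - t B = D, which is why \<gamma>^2 is chosen as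
  n (1 - t^2).\<close>

lemma poly_ip_scaled_hermite_Suc:
  defines "\<gamma> \<equiv> sqrt (n * (1 - t\<^sup>2))"
  shows "poly_ip n t (scaled_hermite \<gamma> t (Suc k)) f =
    of_real (1 / \<gamma>) * poly_ip n t (scaled_hermite \<gamma> t k) (pderiv f)"
proof -
  have "t\<^sup>2 < 1" using t by (simp add: abs_square_less_1)
  then have g: "\<gamma> > 0" "\<gamma>\<^sup>2 = n * (1 - t\<^sup>2)" using n by (auto simp: \<gamma>_def)
  let ?H = "scaled_hermite \<gamma> t k"
  define A where "A = poly_ip n t ([:0, 1:] * ?H) f"
  define B where "B = poly_ip n t (pderiv ?H) f"
  define C where "C = poly_ip n t ?H ([:0, 1:] * f)"
  define D where "D = poly_ip n t ?H (pderiv f)"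
  have "scaled_hermite \<gamma> t (Suc k) =
     smult (of_real \<gamma>) ([:0, 1:] * ?H) - smult (of_real (t / \<gamma>)) (pderiv ?H)"
    using g by (simp add: scaled_hermite_Suc pderiv_scaled_hermite)
  then have 1: "poly_ip n t (scaled_hermite \<gamma> t (Suc k)) f = of_real \<gamma> * A - of_real (t / \<gamma>) * B"
    unfolding A_def B_def by (simp only: poly_ip_diff_left poly_ip_smult_left complex_cnj_complex_of_real)
  have 2: "of_real n * A = D + of_real (n * t) * C"
    unfolding A_def C_def D_def by (rule poly_ip_times_left)
  have "of_real n * C = B + of_real (n * t) * A"
    using arg_cong[OF poly_ip_times_left[of f ?H], of cnj]
    unfolding A_def B_def C_def by (simp only: complex_cnj_mult complex_cnj_add cnj_poly_ip complex_cnj_complex_of_real)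
  then have B: "B = of_real n * C - of_real (n * t) * A" by simp
  have "of_real \<gamma> * (of_real \<gamma> * A - of_real (t / \<gamma>) * B) = of_real (\<gamma>\<^sup>2) * A - of_real t * B"
    using g(1) by (simp add: power2_eq_square algebra_simps)
  also have "\<dots> = D"
    unfolding g(2) B using 2 by (simp add: power2_eq_square algebra_simps)
  finally have *: "of_real \<gamma> * (of_real \<gamma> * A - of_real (t / \<gamma>) * B) = D" .
  have "of_real \<gamma> * A - of_real (t / \<gamma>) * B =
      of_real (1 / \<gamma>) * (of_real \<gamma> * (of_real \<gamma> * A - of_real (t / \<gamma>) * B))"
    using g(1) by simp
  then show ?thesis unfolding 1 * D_def .
qed

text \<open>Each application of adjointness lowers both indices by one and produces the factor
  \<open>l\<close>. If the indices differ, a derivative eventually falls on a constant; if they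
  agree, the factors build up the factorial.\<close>

lemma poly_ip_scaled_hermite:
  defines "\<gamma> \<equiv> sqrt (n * (1 - t\<^sup>2))"
  shows "poly_ip n t (scaled_hermite \<gamma> t k) (scaled_hermite \<gamma> t l) =
    (if k = l then of_real (fact k * pi / (n * sqrt (1 - t\<^sup>2))) else 0)"
proof (induction k arbitrary: l)
  case 0
  show ?case
  proof (cases l)
    case (Suc j)
    have "poly_ip n t (scaled_hermite \<gamma> t l) 1 = 0"
      unfolding Suc \<gamma>_def poly_ip_scaled_hermite_Suc by (simp add: poly_ip_def)
    then have "poly_ip n t 1 (scaled_hermite \<gamma> t l) = 0"
      by (subst cnj_poly_ip[symmetric]) simp
    then show ?thesis using Suc by simp
  qed (simp add: poly_ip_1_1)
next
  case (Suc k)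
  have "t\<^sup>2 < 1" using t by (simp add: abs_square_less_1)
  then have "\<gamma> > 0" using n by (auto simp: \<gamma>_def)
  then have "poly_ip n t (scaled_hermite \<gamma> t (Suc k)) (scaled_hermite \<gamma> t l) =
      of_real (real l) * poly_ip n t (scaled_hermite \<gamma> t k) (scaled_hermite \<gamma> t (l - 1))"
    using poly_ip_scaled_hermite_Suc[of k "scaled_hermite \<gamma> t l", folded \<gamma>_def]
    by (simp add: pderiv_scaled_hermite poly_ip_smult_right)
  then show ?case using Suc.IH[of "l - 1"] by (cases l) auto
qed

end

lemma poly_eq_sum_of_degrees:
  fixes p :: "nat \<Rightarrow> 'a::field poly"
  assumes "\<And>k. degree (p k) = k" "\<And>k. p k \<noteq> 0" "degree f < m"
  shows "\<exists>c. f = (\<Sum>j<m. smult (c j) (p j))"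
  using assms(3)
proof (induction m arbitrary: f)
  case 0
  then show ?case by simp
next
  case (Suc m)
  define a where "a = coeff f m / lead_coeff (p m)"
  have deg: "degree (f - smult a (p m)) \<le> m"
    using Suc.prems assms(1)[of m] by (intro degree_diff_le order_trans[OF degree_smult_le]) auto
  have co: "coeff (f - smult a (p m)) m = 0"
  proof -
    have "coeff (p m) m \<noteq> 0" using assms(1)[of m] assms(2)[of m] by (metis leading_coeff_0_iff)
    then show ?thesis using assms(1)[of m] by (simp add: a_def)
  qed
  show ?case
  \<comment> \<open>A vanishing coefficient \<open>m\<close> lowers the degree bound strictly only
    if \<open>m > 0\<close>; for \<open>m = 0\<close> the remainder is zero outright.\<close>
  proof (cases m)
    case 0
    with deg co have "f = smult a (p m)"
      by (metis le_zero_eq leading_coeff_0_iff right_minus_eq)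
    then show ?thesis using 0 by (intro exI[of _ "\<lambda>_. a"]) simp
  next
    case (Suc m')
    with deg co have "degree (f - smult a (p m)) < m"
      by (metis degree_0 eq_zero_or_degree_less zero_less_Suc)
    from Suc.IH[OF this] obtain c where c: "f - smult a (p m) = (\<Sum>j<m. smult (c j) (p j))" by blast
    have "f = (\<Sum>j<Suc m. smult ((c(m := a)) j) (p j))"
      using c by (simp add: algebra_simps)
    then show ?thesis by blast
  qed
qed

text \<open>Uniqueness is what gives the definite description in \<open>orthonormal_polys\<close>
  its value. After matching leading coefficients, the difference \<open>d\<close> has degree below
  \<open>k\<close> and is orthogonal to all \<open>q j\<close> with \<open>j < k\<close>, hence is
  zero. The remaining factor \<alpha> has modulus 1 and is positive.\<close>

lemma is_orthonormal_polys_unique: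
  fixes n :: nat
  assumes p: "is_orthonormal_polys V n p" and q: "is_orthonormal_polys V n q"
    and int: "\<And>f g. integrable lborel
      (\<lambda>z. cnj (poly f z) * poly g z * of_real (exp (- real n * V z)))"
  shows "p = q"
proof
  fix k
  define B where "B f g = (LINT z|lborel. cnj (poly f z) * poly g z * of_real (exp (- real n * V z)))" for f g
  have add: "B f (g + h) = B f g + B f h" for f g h
    unfolding B_def poly_add distrib_left distrib_right
    by (intro Bochner_Integration.integral_add int)
  have smult: "B f (smult c g) = c * B f g" for f g c
    unfolding B_def
    by (subst integral_mult_right_zero[symmetric])
       (auto intro!: Bochner_Integration.integral_cong simp: algebra_simps)
  have zero: "B f 0 = 0" for f using smult[of f 0 0] by simp
  have sum: "B f (\<Sum>j\<in>J. smult (c j) (g j)) = (\<Sum>j\<in>J. c j * B f (g j))" for f g c and J :: "nat set"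
    by (induction J rule: infinite_finite_induct) (auto simp: zero add smult)
  have diff: "B f (g - h) = B f g - B f h" for f g h
    using add[of f g "smult (-1) h"] smult[of f "-1" h] by simp
  have cnj: "B f g = cnj (B g f)" for f g
    unfolding B_def
    by (subst Bochner_Integration.integral_cnj[symmetric], intro Bochner_Integration.integral_cong) (auto simp: mult_ac)
  have deg1: "degree (r j) = j"
    and lead: "lead_coeff (r j) \<in> \<real>" "Re (lead_coeff (r j)) > 0"
    and orth: "B (r i) (r j) = (if i = j then 1 else 0)"
    if "is_orthonormal_polys V n r" for r i j
    using that unfolding is_orthonormal_polys_def B_def by blast+
  have deg: "degree (r j) = j" "r j \<noteq> 0" if "is_orthonormal_polys V n r" for r j
    using deg1[OF that, of j] lead(2)[OF that, of j] by auto
  have perp: "B (r k) f = 0" if r: "is_orthonormal_polys V n r" and f: "degree f < k" for r f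
  proof -
    obtain c where "f = (\<Sum>j<k. smult (c j) (r j))"
      using poly_eq_sum_of_degrees[of r f k] deg[OF r] f by blast
    then show ?thesis by (simp add: sum orth[OF r])
  qed
  define \<alpha> where "\<alpha> = lead_coeff (p k) / lead_coeff (q k)"
  define d where "d = p k - smult \<alpha> (q k)"
  have \<alpha>: "\<alpha> \<in> \<real>" "Re \<alpha> > 0"
    using lead[OF p, of k] lead[OF q, of k] unfolding \<alpha>_def
    by (auto elim!: Reals_cases simp: Re_divide_of_real)
  have "d = 0"
  proof (rule ccontr)
    assume "d \<noteq> 0"
    have "degree d \<le> k"
      unfolding d_def using deg(1)[OF p, of k] deg(1)[OF q, of k]
      by (intro degree_diff_le order_trans[OF degree_smult_le]) auto
    moreover have "coeff d k = 0"
      using deg(1)[OF q, of k] deg(1)[OF p, of k] lead(2)[OF q, of k] by (auto simp: d_def \<alpha>_def)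
    ultimately have dk: "degree d < k"
      using \<open>d \<noteq> 0\<close> by (metis le_neq_implies_less leading_coeff_0_iff)
    obtain c where c: "d = (\<Sum>j<k. smult (c j) (q j))"
      using poly_eq_sum_of_degrees[of q d k] deg[OF q] dk by blast
    have "c j = 0" if j: "j < k" for j
    proof -
      have "B (q j) (p k) = 0" "B (q j) (q k) = 0"
        using perp[OF p, of "q j"] orth[OF q, of j k] deg(1)[OF q, of j] j by (simp_all add: cnj[of "q j"])
      then have "B (q j) d = 0" by (simp add: d_def diff smult)
      moreover have "B (q j) d = c j"
        using j by (simp add: c sum orth[OF q] if_distrib[of "\<lambda>x. _ * x"] sum.delta' cong: if_cong)
      ultimately show ?thesis by simp
    qed
    with c \<open>d \<noteq> 0\<close> show False by simp
  qed
  then have pk: "p k = smult \<alpha> (q k)" by (simp add: d_def)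
  have "1 = B (p k) (p k)" using orth[OF p] by simp
  also have "\<dots> = \<alpha> * cnj (\<alpha> * B (q k) (q k))" by (simp add: pk smult cnj[of "smult \<alpha> (q k)"])
  also have "\<dots> = \<alpha> * cnj \<alpha>" using orth[OF q, of k k] by simp
  finally have "1 = \<alpha> * cnj \<alpha>" .
  moreover obtain a where a: "\<alpha> = of_real a" using \<alpha>(1) by (rule Reals_cases)
  ultimately have "complex_of_real 1 = of_real (a * a)" by simp
  then have "a * a = 1" unfolding of_real_eq_iff by simp
  moreover have "a > 0" using \<alpha>(2) a by simp
  ultimately have "\<alpha> = 1" unfolding a by (simp add: square_eq_1_iff)
  with pk show "p k = q k" by simp
qed

text \<open>For \<open>n = 0\<close> the weight is constant and no orthonormal polynomials exist.
  The limits of the density are therefore derived from what holds eventually in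
  \<open>n\<close>.\<close>

lemma orthonormal_polys_elliptic:
  assumes n: "n > 0" and t: "\<bar>t\<bar> < 1"
  shows "orthonormal_polys (elliptic_potential t) n k =
    smult (of_real (sqrt (real n * sqrt (1 - t\<^sup>2) / (pi * fact k))))
      (scaled_hermite (sqrt (real n * (1 - t\<^sup>2))) t k)"
proof -
  define \<gamma> where "\<gamma> = sqrt (real n * (1 - t\<^sup>2))"
  define c where "c k = sqrt (real n * sqrt (1 - t\<^sup>2) / (pi * fact k))" for k
  define q where "q = (\<lambda>k. smult (of_real (c k)) (scaled_hermite \<gamma> t k))"
  have t2: "t\<^sup>2 < 1" using t by (simp add: abs_square_less_1)
  have n0: "real n > 0" using n by simp
  have pos: "\<gamma> > 0" "c k > 0" for k using t2 n by (auto simp: \<gamma>_def c_def)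
  have c2: "c k * (c k * (fact k * pi / (real n * sqrt (1 - t\<^sup>2)))) = 1" for k
    unfolding mult.assoc[symmetric] c_def using n t2 by (simp add: field_simps)
  have q: "is_orthonormal_polys (elliptic_potential t) n q"
    unfolding is_orthonormal_polys_def poly_ip_def[symmetric]
  proof (intro conjI allI)
    fix k l
    show "poly_ip (real n) t (q k) (q l) = (if k = l then 1 else 0)"
      unfolding q_def \<gamma>_def poly_ip_smult_left[OF n0 t] poly_ip_smult_right[OF n0 t]
        poly_ip_scaled_hermite[OF n0 t]
      using c2[of k] by (auto simp flip: of_real_mult)
    show "degree (q k) = k" using pos(1) pos(2)[of k] by (simp add: q_def degree_scaled_hermite)
    show "lead_coeff (q k) \<in> \<real>" "0 < Re (lead_coeff (q k))"
      using pos(1) pos(2)[of k]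
      by (auto simp: q_def degree_scaled_hermite coeff_scaled_hermite simp flip: of_real_mult of_real_power)
  qed
  have "orthonormal_polys (elliptic_potential t) n = q"
    unfolding orthonormal_polys_def
    by (rule the_equality, rule q) (rule is_orthonormal_polys_unique[OF _ q integrable_poly_ip[OF n0 t]])
  then show ?thesis by (simp add: q_def c_def \<gamma>_def)
qed

section \<open>Mehler's formula\<close>

text \<open>The quotient of \<open>f\<close> by \<open>g\<close> has derivative zero. Cancelling
  \<open>A\<close> needs only \<open>A \<noteq> 0\<close>, since formal power series over a field
  have no zero divisors.\<close>

lemma fps_linear_ode_unique:
  fixes A P f g :: "'a::field_char_0 fps"
  assumes f: "A * fps_deriv f = P * f" and g: "A * fps_deriv g = P * g"
    and A: "A \<noteq> 0" and fg: "fps_nth f 0 = fps_nth g 0" "fps_nth g 0 \<noteq> 0"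
  shows "f = g"
proof -
  have inv: "g * inverse g = 1" using fg(2) by (simp add: inverse_mult_eq_1')
  have "A * fps_deriv (f * inverse g) =
      (A * fps_deriv f) * inverse g - f * inverse g * ((A * fps_deriv g) * inverse g)"
    using fg(2) by (simp add: fps_inverse_deriv power2_eq_square algebra_simps)
  also have "\<dots> = P * f * inverse g - f * inverse g * P * (g * inverse g)"
    unfolding f g by (simp add: algebra_simps)
  also have "\<dots> = 0" unfolding inv by (simp add: algebra_simps)
  finally have "fps_deriv (f * inverse g) = 0" using A by simp
  then have "f * inverse g = fps_const (fps_nth (f * inverse g) 0)"
    by (simp only: fps_deriv_eq_0_iff)
  also have "\<dots> = 1" using fg by simp
  finally have 1: "f * inverse g = 1" .
  have "f = f * inverse g * g" using inv by (simp add: mult_ac)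
  then show ?thesis using 1 by simp
qed

text \<open>With \<open>a\<close>, \<open>b\<close> solutions of the Hermite recurrence, the three series
  \<open>\<Sum> a k b k u\<^sup>k / k!\<close>, \<open>\<Sum> a (k+1) b k u\<^sup>k / k!\<close>, \<open>\<Sum> a k b (k+1) u\<^sup>k / k!\<close> satisfy a closed linear
  system, from which the last two are eliminated.\<close>

lemma mehler_ode:
  fixes a b :: "nat \<Rightarrow> 'a::field_char_0" and t p q :: 'a
  assumes a: "\<And>k. a (Suc k) = p * a k - t * of_nat k * a (k - 1)"
    and b: "\<And>k. b (Suc k) = q * b k - t * of_nat k * b (k - 1)"
  defines "G \<equiv> Abs_fps (\<lambda>k. a k * b k / fact k)"
  defines "D \<equiv> 1 - fps_const (t\<^sup>2) * fps_X\<^sup>2"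
  shows "D\<^sup>2 * fps_deriv G =
    ((fps_const p - fps_const (t * q) * fps_X) * (fps_const q - fps_const (t * p) * fps_X)
      + fps_const (t\<^sup>2) * fps_X * D) * G"
proof -
  define R where "R = Abs_fps (\<lambda>k. a k * b (Suc k) / fact k)"
  define S where "S = Abs_fps (\<lambda>k. a (Suc k) * b k / fact k)"
  \<comment> \<open>Expanding only \<open>a (Suc k)\<close> in the derivative of \<open>G\<close>
    leaves a series in which \<open>b\<close> is shifted twice; \<open>T\<close> names it until it
    too is eliminated.\<close>
  define T where "T = Abs_fps (\<lambda>k. a k * b (Suc (Suc k)) / fact k)"
  \<comment> \<open>The factorial absorbs the factor \<open>Suc m\<close> of the recurrence, so that
    lowering an index becomes multiplication by \<open>fps_X\<close>.\<close>
  have key: "(P * x - t * of_nat (Suc m) * y) * z / fact (Suc m) =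
      P * (x * z / fact (Suc m)) - t * (y * z / fact m)" for P x y z and m :: nat
    unfolding fact_Suc by (simp add: field_simps del: of_nat_Suc)
  have S: "S = fps_const p * G - fps_const t * fps_X * R"
  proof (rule fps_ext)
    fix k show "fps_nth S k = fps_nth (fps_const p * G - fps_const t * fps_X * R) k"
    proof (cases k)
      case (Suc m)
      show ?thesis using key[of p "a (Suc m)" m "a m" "b (Suc m)"]
        by (simp add: Suc S_def G_def R_def mult.assoc[of "fps_const t"] a[of "Suc m"] del: fact_Suc of_nat_Suc)
    qed (simp add: S_def G_def a[of 0])
  qed
  have R: "R = fps_const q * G - fps_const t * fps_X * S"
  proof (rule fps_ext)
    fix k show "fps_nth R k = fps_nth (fps_const q * G - fps_const t * fps_X * S) k"
    proof (cases k)
      case (Suc m)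
      show ?thesis using key[of q "b (Suc m)" m "b m" "a (Suc m)"]
        by (simp add: Suc S_def G_def R_def mult.assoc[of "fps_const t"] b[of "Suc m"] mult.commute[of "a _"]
            del: fact_Suc of_nat_Suc)
    qed (simp add: R_def G_def b[of 0])
  qed
  have T: "T = fps_const q * R - fps_const t * (fps_X * fps_deriv G + G)"
  proof (rule fps_ext)
    fix k show "fps_nth T k = fps_nth (fps_const q * R - fps_const t * (fps_X * fps_deriv G + G)) k"
      by (cases k) (simp_all add: T_def G_def R_def b[of "Suc _"] field_simps del: fact_Suc)
  qed
  have G: "fps_deriv G = fps_const p * R - fps_const t * fps_X * T"
  proof (rule fps_ext)
    fix k
    have "fps_nth (fps_deriv G) k = a (Suc k) * b (Suc k) / fact k"
      by (simp add: G_def field_simps del: of_nat_Suc)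
    also have "\<dots> = fps_nth (fps_const p * R - fps_const t * fps_X * T) k"
    proof (cases k)
      case (Suc m)
      show ?thesis using key[of p "a (Suc m)" m "a m" "b (Suc (Suc m))"]
        by (simp add: Suc T_def R_def mult.assoc[of "fps_const t"] a[of "Suc m"] del: fact_Suc of_nat_Suc)
    qed (simp add: R_def a[of 0])
    finally show "fps_nth (fps_deriv G) k = fps_nth (fps_const p * R - fps_const t * fps_X * T) k" .
  qed
  define X where "X = (fps_X :: 'a fps)"
  define P where "P = fps_const p"
  define Q where "Q = fps_const q"
  define C where "C = fps_const t"
  define G' where "G' = fps_deriv G"
  have D: "D = 1 - C\<^sup>2 * X\<^sup>2" by (simp add: D_def C_def X_def power2_eq_square)
  have r: "D * R = (Q - C * P * X) * G"
    using R S unfolding D P_def[symmetric] Q_def[symmetric] C_def[symmetric] X_def[symmetric]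
    by algebra
  have "D * G' = (P - C * Q * X) * R + C\<^sup>2 * X * G"
    using G T unfolding D P_def[symmetric] Q_def[symmetric] C_def[symmetric] X_def[symmetric] G'_def[symmetric]
    by algebra
  then have "D\<^sup>2 * G' = (P - C * Q * X) * (D * R) + C\<^sup>2 * X * D * G"
    by algebra
  also have "\<dots> = ((P - C * Q * X) * (Q - C * P * X) + C\<^sup>2 * X * D) * G"
    unfolding r by algebra
  finally show ?thesis
    by (simp add: P_def Q_def C_def X_def G'_def power2_eq_square mult.assoc[symmetric])
qed

text \<open>The factor (1 - t^2 u^2)^(-1/2) is written with the principal logarithm. For |t u| < 1
  the real part of 1 - t^2 u^2 is positive, so the kernel is holomorphic on that whole disc.\<close>

definition mehler_kernel :: "complex \<Rightarrow> complex \<Rightarrow> complex \<Rightarrow> complex \<Rightarrow> complex" where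
  "mehler_kernel t p q u = exp (- Ln (1 - t\<^sup>2 * u\<^sup>2) / 2 +
     (p * q * u - t * u\<^sup>2 * (p\<^sup>2 + q\<^sup>2) / 2) / (1 - t\<^sup>2 * u\<^sup>2))"

lemma Re_one_minus_square_pos:
  fixes t u :: complex
  assumes "cmod (t * u) < 1"
  shows "Re (1 - t\<^sup>2 * u\<^sup>2) > 0"
proof -
  have "cmod ((t * u)\<^sup>2) < 1"
    using assms by (simp add: norm_power abs_square_less_1)
  then have "Re ((t * u)\<^sup>2) < 1"
    using complex_Re_le_cmod[of "(t * u)\<^sup>2"] by linarith
  then show ?thesis by (simp add: power_mult_distrib)
qed

text \<open>The logarithmic derivative is the coefficient of \<open>mehler_ode\<close> divided by
  the square of \<open>D\<close>: the kernel and the series satisfy the same equation.\<close>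

lemma mehler_kernel_has_field_derivative:
  assumes "cmod (t * u) < 1"
  defines "D \<equiv> 1 - t\<^sup>2 * u\<^sup>2"
  shows "(mehler_kernel t p q has_field_derivative
     ((p - t * q * u) * (q - t * p * u) + t\<^sup>2 * u * D) / D\<^sup>2 * mehler_kernel t p q u) (at u)"
proof -
  have re: "Re D > 0" using Re_one_minus_square_pos[OF assms(1)] by (simp add: D_def)
  then have nz: "D \<noteq> 0" by (metis less_irrefl zero_complex.sel(1))
  from re have nn: "D \<notin> \<real>\<^sub>\<le>\<^sub>0" by (simp add: complex_nonpos_Reals_iff)
  define N where "N = p * q * u - t * u\<^sup>2 * (p\<^sup>2 + q\<^sup>2) / 2"
  define N' where "N' = p * q - t * u * (p\<^sup>2 + q\<^sup>2)"
  define D' where "D' = - (2 * t\<^sup>2 * u)"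
  have dD: "((\<lambda>u. 1 - t\<^sup>2 * u\<^sup>2) has_field_derivative D') (at u)"
    unfolding D'_def by (auto intro!: derivative_eq_intros)
  have dN: "((\<lambda>u. p * q * u - t * u\<^sup>2 * (p\<^sup>2 + q\<^sup>2) / 2) has_field_derivative N') (at u)"
    unfolding N'_def by (auto intro!: derivative_eq_intros simp: field_simps)
  have dL: "((\<lambda>u. Ln (1 - t\<^sup>2 * u\<^sup>2)) has_field_derivative D' / D) (at u)"
    using DERIV_chain2[OF has_field_derivative_Ln[OF nn[unfolded D_def]] dD]
    by (simp add: D_def field_simps)
  have "((\<lambda>u. - Ln (1 - t\<^sup>2 * u\<^sup>2) / 2 +
      (p * q * u - t * u\<^sup>2 * (p\<^sup>2 + q\<^sup>2) / 2) / (1 - t\<^sup>2 * u\<^sup>2)) has_field_derivative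
      (- (D' / D) / 2 + (N' * D - N * D') / (D * D))) (at u)"
    using nz unfolding D_def N_def
    by (intro DERIV_add DERIV_cdivide DERIV_minus DERIV_divide dL[unfolded D_def] dN dD)
  also have "- (D' / D) / 2 + (N' * D - N * D') / (D * D) = (- (D' * D) / 2 + N' * D - N * D') / D\<^sup>2"
    using nz by (simp add: field_simps power2_eq_square)
  also have "- (D' * D) / 2 + N' * D - N * D' = (p - t * q * u) * (q - t * p * u) + t\<^sup>2 * u * D"
    unfolding N_def N'_def D'_def D_def by (simp add: field_simps power2_eq_square)
  finally show ?thesis
    unfolding mehler_kernel_def by (rule DERIV_fun_exp[THEN DERIV_cong]) (simp add: mult.commute)
qed

text \<open>The kernel and the series solve the same linear equation with value 1 at the origin, so
  their formal power series agree. Convergence on the full disc |t u| < 1 comes from holomorphy of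
  the kernel there, without any growth estimate for \<open>a\<close> and \<open>b\<close>.\<close>

lemma mehler_sums:
  fixes a b :: "nat \<Rightarrow> complex" and t p q :: complex
  assumes a: "\<And>k. a (Suc k) = p * a k - t * of_nat k * a (k - 1)" "a 0 = 1"
    and b: "\<And>k. b (Suc k) = q * b k - t * of_nat k * b (k - 1)" "b 0 = 1"
    and u: "cmod (t * u) < 1"
  shows "(\<lambda>k. a k * b k / fact k * u ^ k) sums mehler_kernel t p q u"
proof -
  \<comment> \<open>For \<open>t = 0\<close> the kernel is entire, hence the extended
    radius.\<close>
  define r where "r = (if t = 0 then \<infinity> else ereal (1 / cmod t))"
  have r: "z \<in> eball 0 r \<longleftrightarrow> cmod (t * z) < 1" for z
    by (auto simp: r_def in_eball_iff norm_mult field_simps)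
  define F where "F = mehler_kernel t p q"
  define f where "f = fps_expansion F 0"
  define G where "G = Abs_fps (\<lambda>k. a k * b k / fact k)"
  define D where "D = 1 - fps_const (t\<^sup>2) * (fps_X :: complex fps)\<^sup>2"
  have hol: "F holomorphic_on eball 0 r"
    unfolding F_def holomorphic_on_def
    using mehler_kernel_has_field_derivative r field_differentiable_at_within field_differentiable_def
    by metis
  have 0: "(0::complex) \<in> eball 0 r" using r[of 0] by (metis mult_zero_right norm_zero zero_less_one)
  have F: "F has_fps_expansion f"
    unfolding f_def by (rule has_fps_expansion_fps_expansion[OF _ 0 hol]) simp
  let ?P = "\<lambda>u. (p - t * q * u) * (q - t * p * u) + t\<^sup>2 * u * (1 - t\<^sup>2 * u\<^sup>2)"
  let ?Q = "(fps_const p - fps_const (t * q) * fps_X) * (fps_const q - fps_const (t * p) * fps_X)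
      + fps_const (t\<^sup>2) * fps_X * D"
  have lhs: "(\<lambda>u. (1 - t\<^sup>2 * u\<^sup>2)\<^sup>2 * deriv F u) has_fps_expansion D\<^sup>2 * fps_deriv f"
    unfolding D_def by (intro fps_expansion_intros F)
  have rhs: "(\<lambda>u. ?P u * F u) has_fps_expansion ?Q * f"
    unfolding D_def by (intro fps_expansion_intros F)
  have "eventually (\<lambda>u. u \<in> eball 0 r) (nhds (0::complex))"
    using 0 by (intro eventually_nhds_in_open) auto
  then have "eventually (\<lambda>u. (1 - t\<^sup>2 * u\<^sup>2)\<^sup>2 * deriv F u = ?P u * F u) (nhds 0)"
  proof eventually_elim
    case (elim u)
    then have u: "cmod (t * u) < 1" using r by simp
    then have "1 - t\<^sup>2 * u\<^sup>2 \<noteq> 0" using Re_one_minus_square_pos[OF u] by (metis less_irrefl zero_complex.sel(1))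
    then show ?case
      unfolding F_def DERIV_imp_deriv[OF mehler_kernel_has_field_derivative[OF u]] by simp
  qed
  then have "(\<lambda>u. (1 - t\<^sup>2 * u\<^sup>2)\<^sup>2 * deriv F u) has_fps_expansion ?Q * f"
    by (rule has_fps_expansion_cong[OF _ refl, THEN iffD2]) (rule rhs)
  then have ode: "D\<^sup>2 * fps_deriv f = ?Q * f"
    by (rule fps_expansion_unique_complex[OF lhs])
  have "f = G"
  proof (rule fps_linear_ode_unique[OF ode])
    show "D\<^sup>2 * fps_deriv G = ?Q * G"
      unfolding G_def D_def by (rule mehler_ode[OF a(1) b(1)])
    have "fps_nth D 0 = 1" by (simp add: D_def)
    then show "D\<^sup>2 \<noteq> 0" by auto
    show "fps_nth f 0 = fps_nth G 0"
      using a(2) b(2) by (simp add: f_def G_def fps_expansion_def F_def mehler_kernel_def)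
    show "fps_nth G 0 \<noteq> 0" using a(2) b(2) by (simp add: G_def)
  qed
  moreover have "(\<lambda>k. fps_nth f k * u ^ k) sums F u"
    by (rule has_fps_expansion_imp_sums_complex[OF F hol]) (use u r[of u] in \<open>simp add: in_eball_iff\<close>)
  ultimately show ?thesis by (simp add: G_def F_def)
qed

section \<open>The distribution of the weights\<close>

definition density_weight :: "nat \<Rightarrow> real \<Rightarrow> complex \<Rightarrow> nat \<Rightarrow> real" where
  "density_weight n t z k = sqrt (1 - t\<^sup>2) * exp (- real n * elliptic_potential t z) *
     (cmod (poly (scaled_hermite (sqrt (real n * (1 - t\<^sup>2))) t k) z))\<^sup>2 / fact k"

lemma eigenvalue_density_elliptic:
  assumes n: "n > 0" and t: "\<bar>t\<bar> < 1"
  shows "eigenvalue_density (elliptic_potential t) n z = (\<Sum>k<n. density_weight n t z k) / pi"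
proof -
  have t2: "t\<^sup>2 < 1" using t by (simp add: abs_square_less_1)
  show ?thesis
    unfolding eigenvalue_density_def sum_distrib_left sum_divide_distrib
    using n t2
    by (intro sum.cong refl)
       (simp add: orthonormal_polys_elliptic[OF n t] density_weight_def norm_mult power_mult_distrib field_simps)
qed

text \<open>The generating function depends on \<open>z\<close> only through \<open>X\<close> and
  \<open>Y\<close>. They are independent arguments here, so that a point of the ellipse is treated
  by substituting \<open>1 - X\<close> for \<open>Y\<close>.\<close>

definition density_pgf :: "nat \<Rightarrow> real \<Rightarrow> real \<Rightarrow> real \<Rightarrow> complex \<Rightarrow> complex" where
  "density_pgf n t X Y u = of_real (sqrt (1 - t\<^sup>2)) *
     exp (- Ln (1 - (of_real t)\<^sup>2 * u\<^sup>2) / 2 + of_nat n * (u - 1) *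
       (of_real (X * (1 + t)) / (1 + of_real t * u) + of_real (Y * (1 - t)) / (1 - of_real t * u)))"

lemma density_weight_nonneg: "\<bar>t\<bar> < 1 \<Longrightarrow> density_weight n t z k \<ge> 0"
  by (simp add: density_weight_def abs_square_le_1)

lemma semi_axes_squared:
  assumes "\<bar>t\<bar> < 1"
  shows "(semi_major t)\<^sup>2 = (1 + t) / (1 - t)" "(semi_minor t)\<^sup>2 = (1 - t) / (1 + t)"
  using assms by (simp_all add: semi_major_def semi_minor_def)

text \<open>The coefficients of the Hermite polynomials are real, so |H k z|^2 is H k z times H k
  (cnj z), and Mehler's formula applies with \<open>p\<close> and \<open>q\<close> conjugate
  multiples of \<open>z\<close> and \<open>cnj z\<close>.\<close>

lemma density_weight_sums:
  assumes t: "\<bar>t\<bar> < 1" and u: "cmod (of_real t * u) < 1"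
  defines "X z \<equiv> (Re z)\<^sup>2 / (semi_major t)\<^sup>2" and "Y z \<equiv> (Im z)\<^sup>2 / (semi_minor t)\<^sup>2"
  shows "(\<lambda>k. of_real (density_weight n t z k) * u ^ k) sums density_pgf n t (X z) (Y z) u"
proof -
  define \<gamma> where "\<gamma> = sqrt (real n * (1 - t\<^sup>2))"
  define T x y where "T = complex_of_real t" and "x = complex_of_real (Re z)" and "y = complex_of_real (Im z)"
  define p q where "p = of_real \<gamma> * z" and "q = of_real \<gamma> * cnj z"
  have t2: "t\<^sup>2 < 1" using t by (simp add: abs_square_less_1)
  have \<gamma>2: "(complex_of_real \<gamma>)\<^sup>2 = of_nat n * (1 - T\<^sup>2)"
    using t2 by (simp add: \<gamma>_def T_def flip: of_real_power)
  have z: "z = x + \<i> * y" "cnj z = x - \<i> * y"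
    by (simp_all add: x_def y_def complex_eq_iff)
  have pq: "p * q = of_nat n * (1 - T\<^sup>2) * (x\<^sup>2 + y\<^sup>2)"
    unfolding p_def q_def \<gamma>2[symmetric] z(2) unfolding z(1) by (simp add: power2_eq_square algebra_simps)
  have pq2: "p\<^sup>2 + q\<^sup>2 = of_nat n * (1 - T\<^sup>2) * (2 * (x\<^sup>2 - y\<^sup>2))"
    unfolding p_def q_def \<gamma>2[symmetric] z(2) unfolding z(1) by (simp add: power2_eq_square algebra_simps)
  have s: "(\<lambda>k. poly (scaled_hermite \<gamma> t k) z * poly (scaled_hermite \<gamma> t k) (cnj z) / fact k * u ^ k)
      sums mehler_kernel T p q u"
    using u by (intro mehler_sums) (simp_all add: poly_scaled_hermite_Suc p_def q_def T_def mult.assoc)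
  define c where "c = complex_of_real (sqrt (1 - t\<^sup>2)) * of_real (exp (- real n * elliptic_potential t z))"
  have w: "c * (poly (scaled_hermite \<gamma> t k) z * poly (scaled_hermite \<gamma> t k) (cnj z) / fact k * u ^ k) =
      of_real (density_weight n t z k) * u ^ k" for k
    unfolding density_weight_def \<gamma>_def[symmetric] cnj_poly_scaled_hermite[symmetric]
      complex_norm_square[symmetric]
    by (simp add: c_def flip: of_real_power)
  have V: "complex_of_real (- real n * elliptic_potential t z) =
      - (of_nat n * ((1 - T) * x\<^sup>2 + (1 + T) * y\<^sup>2))"
  proof -
    have "elliptic_potential t z = (1 - t) * (Re z)\<^sup>2 + (1 + t) * (Im z)\<^sup>2"
      unfolding elliptic_potential_def cmod_power2 by (simp add: power2_eq_square algebra_simps)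
    then show ?thesis by (simp add: T_def x_def y_def)
  qed
  have XY: "complex_of_real (X z * (1 + t)) = (1 - T) * x\<^sup>2" "complex_of_real (Y z * (1 - t)) = (1 + T) * y\<^sup>2"
  proof -
    have "X z * (1 + t) = (1 - t) * (Re z)\<^sup>2" "Y z * (1 - t) = (1 + t) * (Im z)\<^sup>2"
      using t by (auto simp: X_def Y_def semi_axes_squared[OF t])
    then show "complex_of_real (X z * (1 + t)) = (1 - T) * x\<^sup>2" "complex_of_real (Y z * (1 - t)) = (1 + T) * y\<^sup>2"
      by (simp_all add: T_def x_def y_def)
  qed
  have nz: "1 + T * u \<noteq> 0" "1 - T * u \<noteq> 0"
  proof -
    show "1 + T * u \<noteq> 0"
    proof
      assume "1 + T * u = 0"
      then have "T * u = -1" by (simp add: add_eq_0_iff)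
      with u show False by (simp add: T_def)
    qed
    show "1 - T * u \<noteq> 0" using u by (auto simp: T_def)
  qed
  have D: "1 - T\<^sup>2 * u\<^sup>2 = (1 + T * u) * (1 - T * u)" by (simp add: power2_eq_square algebra_simps)
  \<comment> \<open>The potential and the Mehler exponent cancel at \<open>u = 1\<close>. Hence
    \<open>u - 1\<close> factors out, and the cofactor splits into partial fractions over
    \<open>1 + T * u\<close> and \<open>1 - T * u\<close>.\<close>
  have "- (of_nat n * ((1 - T) * x\<^sup>2 + (1 + T) * y\<^sup>2)) +
      (p * q * u - T * u\<^sup>2 * (p\<^sup>2 + q\<^sup>2) / 2) / (1 - T\<^sup>2 * u\<^sup>2) =
      of_nat n * (u - 1) * ((1 - T) * x\<^sup>2 / (1 + T * u) + (1 + T) * y\<^sup>2 / (1 - T * u))"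
  proof -
    have "((1 - T\<^sup>2) * (x\<^sup>2 + y\<^sup>2) * u - T * u\<^sup>2 * ((1 - T\<^sup>2) * (2 * (x\<^sup>2 - y\<^sup>2))) / 2) =
      ((1 - T) * x\<^sup>2 + (1 + T) * y\<^sup>2) * ((1 + T * u) * (1 - T * u)) +
      (u - 1) * ((1 - T) * x\<^sup>2 * (1 - T * u) + (1 + T) * y\<^sup>2 * (1 + T * u))"
      by (simp add: power2_eq_square field_simps)
    then have "((1 - T\<^sup>2) * (x\<^sup>2 + y\<^sup>2) * u - T * u\<^sup>2 * ((1 - T\<^sup>2) * (2 * (x\<^sup>2 - y\<^sup>2))) / 2) / (1 - T\<^sup>2 * u\<^sup>2) =
      (1 - T) * x\<^sup>2 + (1 + T) * y\<^sup>2 + (u - 1) * ((1 - T) * x\<^sup>2 / (1 + T * u) + (1 + T) * y\<^sup>2 / (1 - T * u))"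
      unfolding D using nz by (simp add: divide_simps)
    moreover have "(p * q * u - T * u\<^sup>2 * (p\<^sup>2 + q\<^sup>2) / 2) =
      of_nat n * ((1 - T\<^sup>2) * (x\<^sup>2 + y\<^sup>2) * u - T * u\<^sup>2 * ((1 - T\<^sup>2) * (2 * (x\<^sup>2 - y\<^sup>2))) / 2)"
      unfolding pq pq2 by (simp add: algebra_simps)
    moreover have "- (N * V) + N * M / E = N * (u - 1) * W" if "M / E = V + (u - 1) * W"
      for N V M E W :: complex
      unfolding times_divide_eq_right[symmetric] that by (simp add: algebra_simps)
    ultimately show ?thesis by (simp only:)
  qed
  then have "c * mehler_kernel T p q u = density_pgf n t (X z) (Y z) u"
    unfolding c_def mehler_kernel_def density_pgf_def exp_of_real[symmetric] V XY T_def[symmetric]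
      mult.assoc exp_add[symmetric]
    by (simp add: algebra_simps)
  then show ?thesis using sums_mult[OF s, of c] unfolding w by simp
qed

lemma density_pgf_of_real:
  assumes t: "\<bar>t\<bar> < 1" and u: "\<bar>t * u\<bar> < 1"
  shows "density_pgf n t X Y (of_real u) = of_real (sqrt ((1 - t\<^sup>2) / (1 - (t * u)\<^sup>2)) *
    exp (real n * (u - 1) * (X * (1 + t) / (1 + t * u) + Y * (1 - t) / (1 - t * u))))"
proof -
  have d: "1 - (t * u)\<^sup>2 > 0" using u by (simp add: abs_square_less_1)
  have "1 - (complex_of_real t)\<^sup>2 * (complex_of_real u)\<^sup>2 = of_real (1 - (t * u)\<^sup>2)"
    by (simp add: power_mult_distrib)
  then have "- Ln (1 - (complex_of_real t)\<^sup>2 * (complex_of_real u)\<^sup>2) / 2 = of_real (- ln (1 - (t * u)\<^sup>2) / 2)"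
    using d by (simp only: Ln_of_real) simp
  moreover have "exp (- ln (1 - (t * u)\<^sup>2) / 2) = 1 / sqrt (1 - (t * u)\<^sup>2)"
    using d by (simp add: ln_sqrt[symmetric] exp_minus field_simps)
  then have "exp (complex_of_real (- ln (1 - (t * u)\<^sup>2) / 2)) = of_real (1 / sqrt (1 - (t * u)\<^sup>2))"
    by (simp only: exp_of_real)
  moreover have "exp (complex_of_real (real n * (u - 1) * (X * (1 + t) / (1 + t * u) + Y * (1 - t) / (1 - t * u)))) =
      of_real (exp (real n * (u - 1) * (X * (1 + t) / (1 + t * u) + Y * (1 - t) / (1 - t * u))))"
    by (simp only: exp_of_real)
  ultimately show ?thesis
    unfolding density_pgf_def exp_add real_sqrt_divide by (simp del: exp_of_real)
qed

lemma density_weight_sums_real: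
  assumes t: "\<bar>t\<bar> < 1" and u: "\<bar>t * u\<bar> < 1"
  defines "X z \<equiv> (Re z)\<^sup>2 / (semi_major t)\<^sup>2" and "Y z \<equiv> (Im z)\<^sup>2 / (semi_minor t)\<^sup>2"
  shows "(\<lambda>k. density_weight n t z k * u ^ k) sums (sqrt ((1 - t\<^sup>2) / (1 - (t * u)\<^sup>2)) *
    exp (real n * (u - 1) * (X z * (1 + t) / (1 + t * u) + Y z * (1 - t) / (1 - t * u))))"
proof -
  have "cmod (of_real t * of_real u) < 1" using u by (simp add: norm_mult abs_mult)
  from density_weight_sums[OF t this, of n z, folded X_def Y_def]
  have "(\<lambda>k. complex_of_real (density_weight n t z k * u ^ k)) sums density_pgf n t (X z) (Y z) (of_real u)"
    by simp
  then show ?thesis unfolding density_pgf_of_real[OF t u] sums_of_real_iff .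
qed

lemma density_weight_sums_1:
  assumes t: "\<bar>t\<bar> < 1"
  shows "density_weight n t z sums 1"
proof -
  have "1 - t\<^sup>2 \<noteq> 0" using t by (simp add: power2_eq_1_iff) arith
  then show ?thesis using density_weight_sums_real[OF t, of 1 n z] t by simp
qed

section \<open>Chernoff bounds inside and outside the ellipse\<close>

lemma chernoff_upper:
  fixes A :: "nat \<Rightarrow> real"
  assumes "\<And>k. A k \<ge> 0" "A sums 1" "(\<lambda>k. A k * u ^ k) sums F" "u \<ge> 1"
  shows "1 - (\<Sum>k<n. A k) \<le> F / u ^ n"
proof -
  have 1: "(\<lambda>k. u ^ n * A (k + n)) sums (u ^ n * (1 - (\<Sum>k<n. A k)))"
    by (intro sums_mult sums_split_initial_segment assms)
  have 2: "(\<lambda>k. A (k + n) * u ^ (k + n)) sums (F - (\<Sum>k<n. A k * u ^ k))"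
    by (intro sums_split_initial_segment assms)
  \<comment> \<open>For \<open>u \<ge> 1\<close> every index from \<open>n\<close> on satisfies u^n
    \<le> u^k, so the tail is dominated by the generating function.\<close>
  have "u ^ n * (1 - (\<Sum>k<n. A k)) \<le> F - (\<Sum>k<n. A k * u ^ k)"
  proof (rule sums_le[OF _ 1 2])
    fix k
    have "A (k + n) * u ^ n \<le> A (k + n) * u ^ (k + n)"
      using assms by (intro mult_left_mono power_increasing) auto
    then show "u ^ n * A (k + n) \<le> A (k + n) * u ^ (k + n)" by (simp add: mult.commute)
  qed
  moreover have "(\<Sum>k<n. A k * u ^ k) \<ge> 0" using assms by (intro sum_nonneg) auto
  ultimately show ?thesis using assms(4) by (simp add: field_simps)
qed

lemma chernoff_lower:
  fixes A :: "nat \<Rightarrow> real"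
  assumes "\<And>k. A k \<ge> 0" "(\<lambda>k. A k * u ^ k) sums F" "0 < u" "u \<le> 1"
  shows "(\<Sum>k<n. A k) \<le> F / u ^ n"
proof -
  \<comment> \<open>For \<open>u \<le> 1\<close> it is the indices below \<open>n\<close> that
    satisfy u^n \<le> u^k.\<close>
  have "u ^ n * (\<Sum>k<n. A k) \<le> (\<Sum>k<n. A k * u ^ k)"
    unfolding sum_distrib_left
    using assms by (intro sum_mono) (auto simp: mult.commute intro!: mult_left_mono power_decreasing)
  also have "\<dots> \<le> F"
    using sum_le_suminf[of "\<lambda>k. A k * u ^ k" "{..<n}"] assms sums_unique[OF assms(2)] sums_summable[OF assms(2)]
    by auto
  finally show ?thesis using assms(3) by (simp add: field_simps)
qed

text \<open>The tail is bounded with \<open>u = 1 + s\<close>. Writing \<open>B\<close> for the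
  bracket in the exponent, the rate is s B - ln (1 + s). The choice s = \<eta>
  \<open>\<delta>\<^sub>0\<close> / 4 keeps t u below 1 - \<open>\<delta>\<^sub>0\<close> / 2 and
  makes \<open>B\<close> at most 1 - \<eta> / 2. As ln (1 + s) is at least s - s^2 and s \<le>
  \<eta> / 4, the rate is at most - s \<eta> / 4, which is the exponent in the statement.\<close>

lemma eigenvalue_density_interior_bound:
  assumes \<delta>\<^sub>0: "0 < \<delta>\<^sub>0" "\<delta>\<^sub>0 < 1" and \<eta>: "0 < \<eta>" "\<eta> \<le> 1"
    and n: "n > 0" and t: "0 < t" "t < 1 - \<delta>\<^sub>0"
    and z: "(Re z)\<^sup>2 / (semi_major t)\<^sup>2 + (Im z)\<^sup>2 / (semi_minor t)\<^sup>2 \<le> 1 - \<eta>"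
  shows "\<bar>eigenvalue_density (elliptic_potential t) n z - 1 / pi\<bar> \<le>
    sqrt (2 / \<delta>\<^sub>0) * exp (- (\<eta>\<^sup>2 * \<delta>\<^sub>0 / 16)) ^ n"
proof -
  define X Y where "X = (Re z)\<^sup>2 / (semi_major t)\<^sup>2" and "Y = (Im z)\<^sup>2 / (semi_minor t)\<^sup>2"
  define s where "s = \<eta> * \<delta>\<^sub>0 / 4"
  have t1: "\<bar>t\<bar> < 1" using t \<delta>\<^sub>0 by simp
  have s: "0 < s" "s \<le> \<delta>\<^sub>0 / 4" "s \<le> \<eta> / 4" "s / \<delta>\<^sub>0 = \<eta> / 4"
    using \<delta>\<^sub>0 \<eta> by (auto simp: s_def mult_left_le_one_le mult_left_le)
  have XY: "X \<ge> 0" "Y \<ge> 0" "X + Y \<le> 1 - \<eta>" using z by (auto simp: X_def Y_def)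
  have ts: "t * s \<le> s" using t s t1 by (simp add: mult_left_le_one_le)
  have tu: "t * (1 + s) < 1 - \<delta>\<^sub>0 / 2"
  proof -
    have "t * (1 + s) = t + t * s" by (simp add: algebra_simps)
    then show ?thesis using ts s(2) t(2) \<delta>\<^sub>0 by linarith
  qed
  have tu0: "t * (1 + s) > 0" using t s by simp
  have tu1: "\<bar>t * (1 + s)\<bar> < 1" using tu tu0 \<delta>\<^sub>0 by simp
  have pre: "sqrt ((1 - t\<^sup>2) / (1 - (t * (1 + s))\<^sup>2)) \<le> sqrt (2 / \<delta>\<^sub>0)"
  proof -
    have "(t * (1 + s))\<^sup>2 \<le> t * (1 + s)"
      using tu0 tu1 by (simp add: power2_eq_square mult_left_le_one_le)
    then have "1 - (t * (1 + s))\<^sup>2 \<ge> \<delta>\<^sub>0 / 2" using tu by linarith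
    moreover have "0 \<le> 1 - t\<^sup>2" "1 - t\<^sup>2 \<le> 1" using t1 by (auto simp: abs_square_le_1)
    ultimately have "(1 - t\<^sup>2) / (1 - (t * (1 + s))\<^sup>2) \<le> 1 / (\<delta>\<^sub>0 / 2)"
      using \<delta>\<^sub>0 by (intro frac_le) auto
    then show ?thesis by simp
  qed
  \<comment> \<open>This term is already at most \<open>X\<close>; it is enlarged so that both terms
    carry the same denominator.\<close>
  have b1: "X * (1 + t) / (1 + t * (1 + s)) \<le> X / (1 - s / \<delta>\<^sub>0)"
  proof -
    have "X * (1 + t) / (1 + t * (1 + s)) \<le> X * 1"
      unfolding times_divide_eq_right[symmetric]
    proof (intro mult_left_mono XY)
      have "t \<le> t * (1 + s)" using t s by simp
      then show "(1 + t) / (1 + t * (1 + s)) \<le> 1" using tu0 by (subst divide_le_eq_1_pos) auto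
    qed
    also have "\<dots> \<le> X / (1 - s / \<delta>\<^sub>0)"
      unfolding divide_inverse using s \<eta> XY by (intro mult_left_mono) (auto simp: field_simps)
    finally show ?thesis .
  qed
  \<comment> \<open>Since 1 - t u = (1 - t) - t s, the quotient is 1 / (1 - t s / (1 - t)), and 1 -
    t exceeds \<open>\<delta>\<^sub>0\<close>.\<close>
  have b2: "Y * (1 - t) / (1 - t * (1 + s)) \<le> Y / (1 - s / \<delta>\<^sub>0)"
  proof -
    have "t * s / (1 - t) \<le> s / \<delta>\<^sub>0" using ts t s \<delta>\<^sub>0 by (intro frac_le) auto
    then have "t * s \<le> s / \<delta>\<^sub>0 * (1 - t)" using t1 by (simp add: field_simps)
    then have "(1 - t) * (1 - s / \<delta>\<^sub>0) \<le> 1 - t * (1 + s)" by (simp add: algebra_simps)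
    then have "(1 - t) / (1 - t * (1 + s)) \<le> 1 / (1 - s / \<delta>\<^sub>0)"
    proof -
      assume *: "(1 - t) * (1 - s / \<delta>\<^sub>0) \<le> 1 - t * (1 + s)"
      have pos: "0 < 1 - s / \<delta>\<^sub>0" unfolding s(4) using \<eta> by simp
      have "(1 - t) / (1 - t * (1 + s)) * (1 - s / \<delta>\<^sub>0) \<le> 1"
        using * tu0 tu1 by (simp add: divide_le_eq_1_pos)
      then show ?thesis using pos by (subst pos_le_divide_eq)
    qed
    from mult_left_mono[OF this XY(2)] show ?thesis by simp
  qed
  have main: "s * (X * (1 + t) / (1 + t * (1 + s)) + Y * (1 - t) / (1 - t * (1 + s))) - ln (1 + s)
      \<le> - (\<eta>\<^sup>2 * \<delta>\<^sub>0 / 16)"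
  proof -
    have "X * (1 + t) / (1 + t * (1 + s)) + Y * (1 - t) / (1 - t * (1 + s)) \<le> (X + Y) / (1 - s / \<delta>\<^sub>0)"
      using b1 b2 by (simp add: add_divide_distrib)
    also have "\<dots> \<le> (1 - \<eta>) / (1 - \<eta> / 4)" unfolding s(4) using XY \<eta> by (intro divide_right_mono) auto
    also have "\<dots> \<le> 1 - \<eta> / 2"
    proof -
      have "(1 - \<eta> / 2) * (1 - \<eta> / 4) = (1 - \<eta>) + \<eta> / 4 + \<eta>\<^sup>2 / 8"
        by (simp add: power2_eq_square field_simps)
      then have "1 - \<eta> \<le> (1 - \<eta> / 2) * (1 - \<eta> / 4)" using \<eta> zero_le_power2[of \<eta>] by linarith
      then show ?thesis using \<eta> by (subst pos_divide_le_eq) auto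
    qed
    finally have "s * (X * (1 + t) / (1 + t * (1 + s)) + Y * (1 - t) / (1 - t * (1 + s))) \<le> s * (1 - \<eta> / 2)"
      using s by (intro mult_left_mono) auto
    moreover have "ln (1 + s) \<ge> s - s\<^sup>2"
      using s \<delta>\<^sub>0 by (intro ln_one_plus_pos_lower_bound) auto
    moreover have "s\<^sup>2 \<le> s * (\<eta> / 4)" unfolding power2_eq_square using s by (intro mult_left_mono) auto
    moreover have "s * (\<eta> / 4) = \<eta>\<^sup>2 * \<delta>\<^sub>0 / 16" by (simp add: s_def power2_eq_square)
    ultimately show ?thesis by (simp add: algebra_simps)
  qed
  define S where "S = (\<Sum>k<n. density_weight n t z k)"
  define B where "B = X * (1 + t) / (1 + t * (1 + s)) + Y * (1 - t) / (1 - t * (1 + s))"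
  have S1: "S \<le> 1"
    using sum_le_suminf[of "density_weight n t z" "{..<n}"] density_weight_nonneg[OF t1]
      sums_unique[OF density_weight_sums_1[OF t1, of n z]] sums_summable[OF density_weight_sums_1[OF t1, of n z]]
    by (auto simp: S_def)
  have "1 - S \<le> sqrt ((1 - t\<^sup>2) / (1 - (t * (1 + s))\<^sup>2)) * exp (real n * ((1 + s) - 1) * B) / (1 + s) ^ n"
    unfolding S_def B_def X_def Y_def
    by (rule chernoff_upper[OF density_weight_nonneg[OF t1] density_weight_sums_1[OF t1]
          density_weight_sums_real[OF t1 tu1]]) (use s in auto)
  also have "(1 + s) ^ n = exp (real n * ln (1 + s))"
    using s by (simp add: exp_of_nat_mult)
  also have "sqrt ((1 - t\<^sup>2) / (1 - (t * (1 + s))\<^sup>2)) * exp (real n * ((1 + s) - 1) * B) / exp (real n * ln (1 + s))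
      = sqrt ((1 - t\<^sup>2) / (1 - (t * (1 + s))\<^sup>2)) * exp (real n * (s * B - ln (1 + s)))"
    by (simp add: exp_diff right_diff_distrib mult.assoc)
  also have "\<dots> \<le> sqrt (2 / \<delta>\<^sub>0) * exp (real n * (- (\<eta>\<^sup>2 * \<delta>\<^sub>0 / 16)))"
  proof (intro mult_mono pre)
    show "exp (real n * (s * B - ln (1 + s))) \<le> exp (real n * (- (\<eta>\<^sup>2 * \<delta>\<^sub>0 / 16)))"
      unfolding exp_le_cancel_iff B_def by (rule mult_left_mono[OF main]) simp
  qed (use \<delta>\<^sub>0 in auto)
  also have "exp (real n * (- (\<eta>\<^sup>2 * \<delta>\<^sub>0 / 16))) = exp (- (\<eta>\<^sup>2 * \<delta>\<^sub>0 / 16)) ^ n"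
    by (rule exp_of_nat_mult)
  finally have "1 - S \<le> sqrt (2 / \<delta>\<^sub>0) * exp (- (\<eta>\<^sup>2 * \<delta>\<^sub>0 / 16)) ^ n" .
  moreover have "\<bar>eigenvalue_density (elliptic_potential t) n z - 1 / pi\<bar> \<le> 1 - S"
  proof -
    have "eigenvalue_density (elliptic_potential t) n z - 1 / pi = - ((1 - S) / pi)"
      unfolding eigenvalue_density_elliptic[OF n t1] S_def by (simp add: field_simps)
    then have "\<bar>eigenvalue_density (elliptic_potential t) n z - 1 / pi\<bar> = (1 - S) / pi"
      using S1 by simp
    also have "\<dots> \<le> (1 - S) / 1" using S1 pi_ge_two by (intro divide_left_mono) auto
    finally show ?thesis by simp
  qed
  ultimately show ?thesis by linarith
qed

text \<open>The mirror image with \<open>u = 1 - s\<close>. Now t u \<le> t, so the root is at most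
  1 and no constant appears. Halving \<open>s\<close> compensates for the weaker logarithm estimate
  ln (1 - s) \<ge> - s - 2 s^2: the bracket is at least 1 + 3 \<eta> / 4, the quadratic term costs
  at most s \<eta> / 4, and the rate - s \<eta> / 2 equals the interior one.\<close>

lemma eigenvalue_density_exterior_bound:
  assumes \<delta>\<^sub>0: "0 < \<delta>\<^sub>0" "\<delta>\<^sub>0 < 1" and \<eta>: "0 < \<eta>" "\<eta> \<le> 1"
    and n: "n > 0" and t: "0 < t" "t < 1 - \<delta>\<^sub>0"
    and z: "(Re z)\<^sup>2 / (semi_major t)\<^sup>2 + (Im z)\<^sup>2 / (semi_minor t)\<^sup>2 \<ge> 1 + \<eta>"
  shows "\<bar>eigenvalue_density (elliptic_potential t) n z\<bar> \<le> exp (- (\<eta>\<^sup>2 * \<delta>\<^sub>0 / 16)) ^ n"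
proof -
  define X Y where "X = (Re z)\<^sup>2 / (semi_major t)\<^sup>2" and "Y = (Im z)\<^sup>2 / (semi_minor t)\<^sup>2"
  define s where "s = \<eta> * \<delta>\<^sub>0 / 8"
  have t1: "\<bar>t\<bar> < 1" using t \<delta>\<^sub>0 by simp
  have s: "0 < s" "s \<le> \<delta>\<^sub>0 / 8" "s \<le> \<eta> / 8" "s / \<delta>\<^sub>0 = \<eta> / 8"
    using \<delta>\<^sub>0 \<eta> by (auto simp: s_def mult_left_le_one_le mult_left_le)
  have s1: "s < 1" using s \<delta>\<^sub>0 by simp
  have XY: "X \<ge> 0" "Y \<ge> 0" "X + Y \<ge> 1 + \<eta>" using z by (auto simp: X_def Y_def)
  have ts: "t * s \<le> s" using t s t1 by (simp add: mult_left_le_one_le)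
  have tu: "t * (1 - s) \<le> t" "t * (1 - s) > 0" using s s1 t by (auto simp: algebra_simps)
  have tu1: "\<bar>t * (1 - s)\<bar> < 1" using tu t1 by simp
  have pre: "sqrt ((1 - t\<^sup>2) / (1 - (t * (1 - s))\<^sup>2)) \<le> 1"
  proof -
    have "(t * (1 - s))\<^sup>2 \<le> t\<^sup>2" using tu by (intro power_mono) auto
    moreover have "t\<^sup>2 < 1" using t1 by (simp add: abs_square_less_1)
    ultimately show ?thesis by simp
  qed
  have b1: "X * (1 + t) / (1 + t * (1 - s)) \<ge> X / (1 + s / \<delta>\<^sub>0)"
  proof -
    have "X / (1 + s / \<delta>\<^sub>0) \<le> X * 1"
      unfolding divide_inverse using s \<eta> XY by (intro mult_left_mono) (auto simp: field_simps)
    also have "\<dots> \<le> X * (1 + t) / (1 + t * (1 - s))"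
      unfolding times_divide_eq_right[symmetric]
      using tu by (intro mult_left_mono XY, subst le_divide_eq_1_pos) auto
    finally show ?thesis .
  qed
  have b2: "Y * (1 - t) / (1 - t * (1 - s)) \<ge> Y / (1 + s / \<delta>\<^sub>0)"
  proof -
    have "t * s / (1 - t) \<le> s / \<delta>\<^sub>0" using ts t s \<delta>\<^sub>0 by (intro frac_le) auto
    then have "t * s \<le> s / \<delta>\<^sub>0 * (1 - t)" using t1 by (simp add: field_simps)
    then have "(1 - t) * (1 + s / \<delta>\<^sub>0) \<ge> 1 - t * (1 - s)" by (simp add: algebra_simps)
    then have "(1 - t) / (1 - t * (1 - s)) \<ge> 1 / (1 + s / \<delta>\<^sub>0)"
    proof -
      assume "1 - t * (1 - s) \<le> (1 - t) * (1 + s / \<delta>\<^sub>0)"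
      then have "(1 - t * (1 - s)) / (1 + s / \<delta>\<^sub>0) \<le> 1 - t"
        using s(1) \<delta>\<^sub>0 by (subst pos_divide_le_eq) (auto intro: add_pos_pos)
      then show ?thesis using tu1 tu by (intro mult_imp_le_div_pos) auto
    qed
    from mult_left_mono[OF this XY(2)] show ?thesis by simp
  qed
  have main: "- s * (X * (1 + t) / (1 + t * (1 - s)) + Y * (1 - t) / (1 - t * (1 - s))) - ln (1 - s)
      \<le> - (\<eta>\<^sup>2 * \<delta>\<^sub>0 / 16)"
  proof -
    have "1 + \<eta> * 3 / 4 \<le> (1 + \<eta>) / (1 + \<eta> / 8)"
    proof -
      have "(1 + \<eta> * 3 / 4) * (1 + \<eta> / 8) = (1 + \<eta>) - \<eta> / 8 + 3 * \<eta>\<^sup>2 / 32"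
        by (simp add: power2_eq_square field_simps)
      moreover have "\<eta>\<^sup>2 \<le> \<eta>" using \<eta> by (simp add: power2_eq_square mult_left_le)
      ultimately have "(1 + \<eta> * 3 / 4) * (1 + \<eta> / 8) \<le> 1 + \<eta>" using \<eta> by linarith
      then show ?thesis using \<eta> by (simp add: pos_le_divide_eq)
    qed
    also have "\<dots> \<le> (X + Y) / (1 + s / \<delta>\<^sub>0)" unfolding s(4) using XY \<eta> by (intro divide_right_mono) auto
    also have "\<dots> \<le> X * (1 + t) / (1 + t * (1 - s)) + Y * (1 - t) / (1 - t * (1 - s))"
      using b1 b2 by (simp add: add_divide_distrib)
    finally have "s * (1 + \<eta> * 3 / 4) \<le> s * (X * (1 + t) / (1 + t * (1 - s)) + Y * (1 - t) / (1 - t * (1 - s)))"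
      using s by (intro mult_left_mono) auto
    moreover have "ln (1 - s) \<ge> - s - 2 * s\<^sup>2"
      using s \<delta>\<^sub>0 by (intro ln_one_minus_pos_lower_bound) auto
    moreover have "s\<^sup>2 \<le> s * (\<eta> / 8)" unfolding power2_eq_square using s by (intro mult_left_mono) auto
    moreover have "s * (\<eta> / 2) = \<eta>\<^sup>2 * \<delta>\<^sub>0 / 16" by (simp add: s_def power2_eq_square)
    moreover have "s * (1 + \<eta> * 3 / 4) = s + 3 / 2 * (s * (\<eta> / 2))" "s * (\<eta> / 8) = s * (\<eta> / 2) / 4"
      by (simp_all add: algebra_simps)
    ultimately show ?thesis unfolding mult_minus_left by linarith
  qed
  define S where "S = (\<Sum>k<n. density_weight n t z k)"
  define B where "B = X * (1 + t) / (1 + t * (1 - s)) + Y * (1 - t) / (1 - t * (1 - s))"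
  have S0: "S \<ge> 0" unfolding S_def by (intro sum_nonneg density_weight_nonneg t1)
  have "S \<le> sqrt ((1 - t\<^sup>2) / (1 - (t * (1 - s))\<^sup>2)) * exp (real n * ((1 - s) - 1) * B) / (1 - s) ^ n"
    unfolding S_def B_def X_def Y_def
    by (rule chernoff_lower[OF density_weight_nonneg[OF t1] density_weight_sums_real[OF t1 tu1]])
       (use s s1 in auto)
  also have "(1 - s) ^ n = exp (real n * ln (1 - s))"
    using s1 by (simp add: exp_of_nat_mult)
  also have "sqrt ((1 - t\<^sup>2) / (1 - (t * (1 - s))\<^sup>2)) * exp (real n * ((1 - s) - 1) * B) / exp (real n * ln (1 - s))
      = sqrt ((1 - t\<^sup>2) / (1 - (t * (1 - s))\<^sup>2)) * exp (real n * (- s * B - ln (1 - s)))"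
    by (simp add: exp_diff right_diff_distrib mult.assoc)
  also have "\<dots> \<le> 1 * exp (real n * (- (\<eta>\<^sup>2 * \<delta>\<^sub>0 / 16)))"
  proof (intro mult_mono pre)
    show "exp (real n * (- s * B - ln (1 - s))) \<le> exp (real n * (- (\<eta>\<^sup>2 * \<delta>\<^sub>0 / 16)))"
      unfolding exp_le_cancel_iff B_def by (rule mult_left_mono[OF main]) simp
  qed auto
  also have "exp (real n * (- (\<eta>\<^sup>2 * \<delta>\<^sub>0 / 16))) = exp (- (\<eta>\<^sup>2 * \<delta>\<^sub>0 / 16)) ^ n"
    by (rule exp_of_nat_mult)
  finally have "S \<le> exp (- (\<eta>\<^sup>2 * \<delta>\<^sub>0 / 16)) ^ n" by simp
  moreover have "\<bar>eigenvalue_density (elliptic_potential t) n z\<bar> \<le> S"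
  proof -
    have "\<bar>eigenvalue_density (elliptic_potential t) n z\<bar> = S / pi"
      unfolding eigenvalue_density_elliptic[OF n t1] S_def[symmetric] using S0 by simp
    also have "\<dots> \<le> S / 1" using S0 pi_ge_two by (intro divide_left_mono) auto
    finally show ?thesis by simp
  qed
  ultimately show ?thesis by linarith
qed

section \<open>Central limit theorem on the ellipse\<close>

definition nat_distribution :: "(nat \<Rightarrow> real) \<Rightarrow> nat measure" where
  "nat_distribution A = density (count_space UNIV) (\<lambda>k. ennreal (A k))"

context
  fixes A :: "nat \<Rightarrow> real"
  assumes A0: "\<And>k. A k \<ge> 0" and A1: "A sums 1"
begin

lemma prob_space_nat_distribution: "prob_space (nat_distribution A)"
proof
  show "emeasure (nat_distribution A) (space (nat_distribution A)) = 1"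
    using suminf_ennreal_eq[OF A0 A1]
    by (simp add: nat_distribution_def emeasure_density nn_integral_count_space_nat)
qed

lemma measure_nat_distribution_lessThan: "measure (nat_distribution A) {..<n} = (\<Sum>k<n. A k)"
proof -
  have "(\<lambda>k. if k \<in> {..<n} then A k else 0) sums (\<Sum>k<n. A k)"
    by (rule sums_If_finite_set) simp
  then have "(\<Sum>k. ennreal (if k \<in> {..<n} then A k else 0)) = ennreal (\<Sum>k<n. A k)"
    by (intro suminf_ennreal_eq) (use A0 in auto)
  moreover have "emeasure (nat_distribution A) {..<n} = (\<Sum>k. ennreal (if k \<in> {..<n} then A k else 0))"
    unfolding nat_distribution_def
    by (subst emeasure_density)
       (auto simp: nn_integral_count_space_nat intro!: suminf_cong split: split_indicator)
  ultimately have "emeasure (nat_distribution A) {..<n} = ennreal (\<Sum>k<n. A k)" by (simp only:)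
  then show ?thesis by (simp add: measure_def sum_nonneg A0)
qed

text \<open>Absolute summability of \<open>A\<close> makes the integral over the naturals agree with
  the ordered sum \<open>S\<close>.\<close>

lemma char_nat_distribution:
  assumes "(\<lambda>k. of_real (A k) * iexp (\<theta> * h k)) sums S"
  shows "char (distr (nat_distribution A) borel h) \<theta> = S"
proof -
  have sp: "h \<in> nat_distribution A \<rightarrow>\<^sub>M borel" by (simp add: nat_distribution_def)
  have "summable A" using A1 by (simp add: sums_iff)
  then have "integrable (count_space UNIV) (\<lambda>k. A k *\<^sub>R iexp (\<theta> * h k))"
    using A0 by (simp add: integrable_count_space_nat_iff)
  from sums_integral_count_space_nat[OF this]
  have *: "(\<integral>k. A k *\<^sub>R iexp (\<theta> * h k) \<partial>count_space UNIV) = S"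
    using assms sums_unique2 by (auto simp: scaleR_conv_of_real)
  have "char (distr (nat_distribution A) borel h) \<theta> = (\<integral>k. iexp (\<theta> * h k) \<partial>nat_distribution A)"
    unfolding char_def using sp by (subst integral_distr) auto
  also have "\<dots> = (\<integral>k. A k *\<^sub>R iexp (\<theta> * h k) \<partial>count_space UNIV)"
    unfolding nat_distribution_def by (subst integral_density) (auto simp: A0)
  finally show ?thesis using * by simp
qed

end

text \<open>Makes the negative half-line a continuity set of the limit law, and lets reflection
  split its mass into two equal halves.\<close>

lemma emeasure_std_normal_singleton_0: "emeasure std_normal_distribution {0} = 0"
proof -
  have "emeasure std_normal_distribution {0} =
      (\<integral>\<^sup>+x. ennreal (std_normal_density x) * indicator {0} x \<partial>lborel)"
    by (simp add: emeasure_density)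
  also have "\<dots> = 0" by (subst nn_integral_indicator_singleton) auto
  finally show ?thesis .
qed

lemma measure_std_normal_lessThan_0: "measure std_normal_distribution {..<0} = 1 / 2"
proof -
  interpret real_distribution std_normal_distribution by (rule real_dist_normal_dist)
  have "emeasure std_normal_distribution {..<0} = (\<integral>\<^sup>+x. ennreal (std_normal_density x) * indicator {..<0} x \<partial>lborel)"
    by (simp add: emeasure_density)
  also have "\<dots> = (\<integral>\<^sup>+x. ennreal (std_normal_density x) * indicator {..<0} x \<partial>distr lborel borel uminus)"
    by (simp add: lborel_distr_uminus)
  also have "\<dots> = (\<integral>\<^sup>+x. ennreal (std_normal_density x) * indicator {0<..} x \<partial>lborel)"
    by (subst nn_integral_distr) (auto intro!: nn_integral_cong simp: normal_density_def indicator_def)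
  also have "\<dots> = emeasure std_normal_distribution {0<..}"
    by (simp add: emeasure_density)
  finally have eq: "measure std_normal_distribution {..<0} = measure std_normal_distribution {0<..}"
    by (simp add: measure_def)
  have 0: "measure std_normal_distribution {0} = 0"
    by (simp add: measure_def emeasure_std_normal_singleton_0)
  have "1 = measure std_normal_distribution (({..<0} \<union> {0}) \<union> {0<..})"
  proof -
    have "({..<0} \<union> {0}) \<union> {0<..} = (UNIV :: real set)" by auto
    then show ?thesis using prob_space unfolding space_eq_univ by simp
  qed
  also have "\<dots> = measure std_normal_distribution {..<0} + measure std_normal_distribution {0}
      + measure std_normal_distribution {0<..}"
    by (subst finite_measure_Union, simp, simp, force, subst finite_measure_Union) auto
  finally show ?thesis using eq 0 by simp
qed

lemma iexp_bounds:
  shows "cmod (iexp v - 1) \<le> \<bar>v\<bar>"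
    and "cmod (iexp v - 1 - \<i> * of_real v) \<le> v\<^sup>2 / 2"
    and "cmod (iexp v - 1 - \<i> * of_real v + (of_real v)\<^sup>2 / 2) \<le> \<bar>v\<bar> ^ 3 / 6"
  using iexp_approx1[of v 0] iexp_approx1[of v 1] iexp_approx1[of v 2]
  by (simp_all add: numeral_2_eq_2 numeral_3_eq_3 algebra_simps power2_eq_square)

text \<open>Second order expansion, at \<open>u = exp (\<i> v)\<close>, of the exponent of the generating function
  divided by \<open>n\<close>, for a point on the ellipse, where \<open>Y = 1 - X\<close>; \<open>\<sigma>2\<close> is the limiting variance.\<close>

lemma pgf_exponent_bound:
  fixes \<delta>\<^sub>0 t X v :: real
  assumes \<delta>\<^sub>0: "0 < \<delta>\<^sub>0" "\<delta>\<^sub>0 < 1" and t: "0 < t" "t < 1 - \<delta>\<^sub>0" and X: "0 \<le> X" "X \<le> 1"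
  defines "\<sigma>2 \<equiv> X * (1 - t) / (1 + t) + (1 - X) * (1 + t) / (1 - t)"
  defines "u \<equiv> iexp v"
  shows "cmod ((u - 1) * (of_real (X * (1 + t)) / (1 + of_real t * u)
      + of_real ((1 - X) * (1 - t)) / (1 - of_real t * u)) - \<i> * of_real v
      + of_real (v\<^sup>2 * \<sigma>2 / 2)) \<le> 3 / \<delta>\<^sub>0\<^sup>2 * \<bar>v\<bar> ^ 3"
proof -
  define T where "T = complex_of_real t"
  define x where "x = complex_of_real X"
  have u1: "cmod u = 1" by (simp add: u_def)
  have T: "cmod T = t" using t by (simp add: T_def)
  have low: "cmod (1 + T * u) \<ge> \<delta>\<^sub>0" "cmod (1 - T * u) \<ge> \<delta>\<^sub>0"
  proof -
    have "cmod 1 - cmod (T * u) \<le> cmod (1 - T * u)" by (rule norm_triangle_ineq2)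
    moreover have "cmod 1 - cmod (- (T * u)) \<le> cmod (1 - - (T * u))" by (rule norm_triangle_ineq2)
    ultimately show "cmod (1 + T * u) \<ge> \<delta>\<^sub>0" "cmod (1 - T * u) \<ge> \<delta>\<^sub>0"
      using t by (auto simp: norm_mult u1 T)
  qed
  then have nz: "1 + T * u \<noteq> 0" "1 - T * u \<noteq> 0" using \<delta>\<^sub>0 by auto
  have nz1: "1 + T \<noteq> 0" "1 - T \<noteq> 0"
    using t \<delta>\<^sub>0 by (auto simp: T_def complex_eq_iff)
  have low1: "cmod (1 + T) \<ge> \<delta>\<^sub>0" "cmod (1 - T) \<ge> \<delta>\<^sub>0"
  proof -
    have "1 + T = of_real (1 + t)" "1 - T = of_real (1 - t)" by (simp_all add: T_def)
    then show "cmod (1 + T) \<ge> \<delta>\<^sub>0" "cmod (1 - T) \<ge> \<delta>\<^sub>0"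
      unfolding norm_of_real using t \<delta>\<^sub>0 by (auto simp del: of_real_add of_real_diff)
  qed
  \<comment> \<open>\<open>B\<close> is the divided difference that extracts the next factor
    \<open>u - 1\<close> from the bracket, whose value at \<open>u = 1\<close> is 1;
    \<open>B1\<close> is \<open>B\<close> at \<open>u = 1\<close> and determines the
    variance.\<close>
  define B where "B = - (x * T) / (1 + T * u) + (1 - x) * T / (1 - T * u)"
  define B1 where "B1 = - (x * T) / (1 + T) + (1 - x) * T / (1 - T)"
  have W: "of_real (X * (1 + t)) / (1 + of_real t * u) + of_real ((1 - X) * (1 - t)) / (1 - of_real t * u)
      = 1 + (u - 1) * B"
  proof -
    have "x * (1 + T) / (1 + T * u) = x * (1 - T * (u - 1) / (1 + T * u))"
      using nz by (simp add: field_simps)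
    moreover have "(1 - x) * (1 - T) / (1 - T * u) = (1 - x) * (1 + T * (u - 1) / (1 - T * u))"
      using nz by (simp add: field_simps)
    moreover have "(u - 1) * B = - (x * (T * (u - 1) / (1 + T * u))) + (1 - x) * (T * (u - 1) / (1 - T * u))"
      unfolding B_def divide_inverse by (simp add: algebra_simps)
    moreover have "x * (1 - E) + (1 - x) * (1 + F) = 1 + (- (x * E) + (1 - x) * F)" for E F
      by (simp add: algebra_simps)
    ultimately show ?thesis by (simp add: T_def x_def)
  qed
  have \<sigma>: "complex_of_real (\<sigma>2 / 2) = 1 / 2 + B1"
  proof -
    have "\<sigma>2 / 2 = 1 / 2 + (- (X * t) / (1 + t) + (1 - X) * t / (1 - t))"
    proof -
      have "(1 - t) / (1 + t) = 1 - 2 * (t / (1 + t))" "(1 + t) / (1 - t) = 1 + 2 * (t / (1 - t))"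
        using t \<delta>\<^sub>0 by (simp_all add: field_simps)
      moreover have "(X * (1 - 2 * a) + (1 - X) * (1 + 2 * b)) / 2 = 1 / 2 + (- X * a + (1 - X) * b)" for a b
        by (simp add: field_simps)
      ultimately show ?thesis
        unfolding \<sigma>2_def times_divide_eq_right[symmetric] mult_minus_left[symmetric] by (simp only:)
    qed
    then show ?thesis by (simp add: B1_def x_def T_def)
  qed
  have cX: "cmod x = X" "cmod (1 - x) = 1 - X"
  proof -
    have "1 - x = of_real (1 - X)" by (simp add: x_def)
    then show "cmod x = X" "cmod (1 - x) = 1 - X" using X by (simp_all add: x_def del: of_real_diff)
  qed
  have Bb: "cmod B \<le> 1 / \<delta>\<^sub>0"
  proof -
    have "cmod B \<le> cmod (- (x * T) / (1 + T * u)) + cmod ((1 - x) * T / (1 - T * u))"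
      unfolding B_def by (rule norm_triangle_ineq)
    also have "\<dots> = X * t / cmod (1 + T * u) + (1 - X) * t / cmod (1 - T * u)"
      using X t by (simp add: norm_divide norm_mult cX T)
    also have "\<dots> \<le> X * 1 / \<delta>\<^sub>0 + (1 - X) * 1 / \<delta>\<^sub>0"
      using X t low \<delta>\<^sub>0 by (intro add_mono frac_le mult_left_mono mult_nonneg_nonneg) auto
    also have "\<dots> = 1 / \<delta>\<^sub>0" by (simp flip: add_divide_distrib)
    finally show ?thesis .
  qed
  have Bd: "cmod (B - B1) \<le> \<bar>v\<bar> / \<delta>\<^sub>0\<^sup>2"
  proof -
    have "B - B1 = x * T * T * (u - 1) / ((1 + T) * (1 + T * u)) + (1 - x) * T * T * (u - 1) / ((1 - T) * (1 - T * u))"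
    proof -
      have "x * T / (1 + T) - x * T / (1 + T * u) = x * T * T * (u - 1) / ((1 + T) * (1 + T * u))"
        using nz nz1 by (simp add: diff_frac_eq) (simp add: algebra_simps)
      moreover have "(1 - x) * T / (1 - T * u) - (1 - x) * T / (1 - T) = (1 - x) * T * T * (u - 1) / ((1 - T) * (1 - T * u))"
        using nz nz1 by (simp add: diff_frac_eq) (simp add: algebra_simps)
      ultimately show ?thesis unfolding B_def B1_def by (simp add: algebra_simps)
    qed
    also have "cmod \<dots> \<le> cmod (x * T * T * (u - 1) / ((1 + T) * (1 + T * u)))
        + cmod ((1 - x) * T * T * (u - 1) / ((1 - T) * (1 - T * u)))"
      by (rule norm_triangle_ineq)
    also have "\<dots> = X * t * t * cmod (u - 1) / (cmod (1 + T) * cmod (1 + T * u))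
        + (1 - X) * t * t * cmod (u - 1) / (cmod (1 - T) * cmod (1 - T * u))"
      by (simp add: norm_divide norm_mult cX T)
    also have "\<dots> \<le> X * 1 * 1 * \<bar>v\<bar> / (\<delta>\<^sub>0 * \<delta>\<^sub>0) + (1 - X) * 1 * 1 * \<bar>v\<bar> / (\<delta>\<^sub>0 * \<delta>\<^sub>0)"
      using X t low low1 \<delta>\<^sub>0 iexp_bounds(1)[of v, folded u_def]
      by (intro add_mono frac_le mult_mono mult_nonneg_nonneg) auto
    also have "\<dots> = \<bar>v\<bar> / \<delta>\<^sub>0\<^sup>2" by (simp add: power2_eq_square algebra_simps flip: add_divide_distrib)
    finally show ?thesis .
  qed
  define V where "V = complex_of_real v"
  have V: "cmod V = \<bar>v\<bar>" by (simp add: V_def)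
  have d3: "cmod (u - 1 - \<i> * V + V\<^sup>2 / 2) \<le> \<bar>v\<bar> ^ 3 / 6"
    using iexp_bounds(3)[of v] by (simp add: u_def V_def)
  have d2: "cmod ((u - 1)\<^sup>2 + V\<^sup>2) \<le> \<bar>v\<bar> ^ 3"
  proof -
    have "(u - 1)\<^sup>2 + V\<^sup>2 = (u - 1 - \<i> * V) * (u - 1 + \<i> * V)"
      by (simp add: power2_eq_square algebra_simps)
    then have "cmod ((u - 1)\<^sup>2 + V\<^sup>2) = cmod (u - 1 - \<i> * V) * cmod (u - 1 + \<i> * V)"
      by (simp add: norm_mult)
    also have "\<dots> \<le> (v\<^sup>2 / 2) * (\<bar>v\<bar> + \<bar>v\<bar>)"
      using iexp_bounds(1,2)[of v] norm_triangle_ineq[of "u - 1" "\<i> * V"]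
      by (intro mult_mono) (auto simp: u_def V_def norm_mult)
    also have "\<dots> = \<bar>v\<bar> ^ 3" by (simp add: power2_eq_square power3_eq_cube)
    finally show ?thesis .
  qed
  \<comment> \<open>Three sources of error, each cubic in \<open>v\<close>: the Taylor remainder of
    \<open>u\<close>, the replacement of (u - 1)^2 by - v^2, and the replacement of \<open>B\<close>
    by \<open>B1\<close>.\<close>
  have "(u - 1) * (1 + (u - 1) * B) - \<i> * V + V\<^sup>2 * (1 / 2 + B1) =
      (u - 1 - \<i> * V + V\<^sup>2 / 2) + ((u - 1)\<^sup>2 + V\<^sup>2) * B - V\<^sup>2 * (B - B1)"
    by (simp add: power2_eq_square algebra_simps)
  also have "cmod \<dots> \<le> cmod (u - 1 - \<i> * V + V\<^sup>2 / 2) + cmod ((u - 1)\<^sup>2 + V\<^sup>2) * cmod B + \<bar>v\<bar>\<^sup>2 * cmod (B - B1)"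
    by (rule order_trans[OF norm_triangle_ineq4], rule add_mono, rule order_trans[OF norm_triangle_ineq])
       (simp_all add: norm_mult norm_power V)
  also have "\<dots> \<le> \<bar>v\<bar> ^ 3 / 6 + \<bar>v\<bar> ^ 3 * (1 / \<delta>\<^sub>0) + \<bar>v\<bar>\<^sup>2 * (\<bar>v\<bar> / \<delta>\<^sub>0\<^sup>2)"
    using d3 d2 Bb Bd by (intro add_mono mult_mono mult_left_mono) auto
  also have "\<dots> = (1 / 6 + 1 / \<delta>\<^sub>0 + 1 / \<delta>\<^sub>0\<^sup>2) * \<bar>v\<bar> ^ 3"
    by (simp add: power2_eq_square power3_eq_cube algebra_simps)
  also have "\<dots> \<le> 3 / \<delta>\<^sub>0\<^sup>2 * \<bar>v\<bar> ^ 3"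
  proof (intro mult_right_mono)
    have "\<delta>\<^sub>0\<^sup>2 \<le> \<delta>\<^sub>0" "\<delta>\<^sub>0\<^sup>2 \<le> 1" using \<delta>\<^sub>0 by (auto simp: power2_eq_square mult_le_one mult_left_le)
    then have "1 / \<delta>\<^sub>0 \<le> 1 / \<delta>\<^sub>0\<^sup>2" "1 \<le> 1 / \<delta>\<^sub>0\<^sup>2" using \<delta>\<^sub>0 by (auto intro!: divide_left_mono)
    then have "1 / 6 + 1 / \<delta>\<^sub>0 + 1 / \<delta>\<^sub>0\<^sup>2 \<le> 3 * (1 / \<delta>\<^sub>0\<^sup>2)" by linarith
    then show "1 / 6 + 1 / \<delta>\<^sub>0 + 1 / \<delta>\<^sub>0\<^sup>2 \<le> 3 / \<delta>\<^sub>0\<^sup>2" by simp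
  qed auto
  finally have fin: "cmod ((u - 1) * (1 + (u - 1) * B) - \<i> * V + V\<^sup>2 * (1 / 2 + B1)) \<le> 3 / \<delta>\<^sub>0\<^sup>2 * \<bar>v\<bar> ^ 3" .
  have "complex_of_real (v\<^sup>2 * \<sigma>2 / 2) = V\<^sup>2 * (1 / 2 + B1)"
    unfolding \<sigma>[symmetric] V_def by simp
  then show ?thesis using fin unfolding W V_def[symmetric] by simp
qed

text \<open>The variance \<open>\<sigma>2 n\<close> varies with \<open>n\<close> but stays above
  \<open>\<delta>\<^sub>0 / 2\<close>, so \<open>v n\<close> is of order n^(-1/2) along any sequence
  of parameters. The quadratic term of the exponent is then exactly - \<theta>^2 / 2 for
  \<open>n > 0\<close>, the cubic remainder contributes a multiple of |v|, and the root tends to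
  1.\<close>

lemma density_pgf_normalised_tendsto:
  fixes \<delta>\<^sub>0 \<theta> :: real and t X :: "nat \<Rightarrow> real"
  assumes \<delta>\<^sub>0: "0 < \<delta>\<^sub>0" "\<delta>\<^sub>0 < 1"
    and t: "\<And>n. 0 < t n" "\<And>n. t n < 1 - \<delta>\<^sub>0" and X: "\<And>n. 0 \<le> X n" "\<And>n. X n \<le> 1"
  defines "\<sigma>2 \<equiv> \<lambda>n. X n * (1 - t n) / (1 + t n) + (1 - X n) * (1 + t n) / (1 - t n)"
  defines "v \<equiv> \<lambda>n. \<theta> / sqrt (real n * \<sigma>2 n)"
  shows "(\<lambda>n. iexp (- v n * real n) * density_pgf n (t n) (X n) (1 - X n) (iexp (v n)))
    \<longlonglongrightarrow> of_real (exp (- \<theta>\<^sup>2 / 2))"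
proof -
  have \<sigma>: "\<sigma>2 n \<ge> \<delta>\<^sub>0 / 2" for n
  proof -
    have "X n * (\<delta>\<^sub>0 / 2) + (1 - X n) * (\<delta>\<^sub>0 / 2) \<le> X n * ((1 - t n) / (1 + t n)) + (1 - X n) * ((1 + t n) / (1 - t n))"
    proof (intro add_mono mult_left_mono)
      show "\<delta>\<^sub>0 / 2 \<le> (1 - t n) / (1 + t n)" using t[of n] \<delta>\<^sub>0 by (intro frac_le) auto
      have "1 / 1 \<le> (1 + t n) / (1 - t n)" using t[of n] \<delta>\<^sub>0 by (intro frac_le) auto
      then show "\<delta>\<^sub>0 / 2 \<le> (1 + t n) / (1 - t n)" using \<delta>\<^sub>0 by linarith
    qed (use X[of n] in auto)
    moreover have "X n * (\<delta>\<^sub>0 / 2) + (1 - X n) * (\<delta>\<^sub>0 / 2) = \<delta>\<^sub>0 / 2" by (simp add: field_simps)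
    ultimately show ?thesis unfolding \<sigma>2_def times_divide_eq_right[symmetric] by linarith
  qed
  then have \<sigma>0: "\<sigma>2 n > 0" for n using \<delta>\<^sub>0 by (meson half_gt_zero less_le_trans)
  have v0: "v \<longlonglongrightarrow> 0"
  proof (rule Lim_null_comparison)
    show "(\<lambda>n. (\<bar>\<theta>\<bar> / sqrt (\<delta>\<^sub>0 / 2)) * (1 / sqrt (real n))) \<longlonglongrightarrow> 0"
      using tendsto_real_sqrt[OF lim_1_over_n[where ?'a = real]]
      by (intro tendsto_mult_right_zero) (simp add: real_sqrt_divide)
    show "\<forall>\<^sub>F n in sequentially. norm (v n) \<le> (\<bar>\<theta>\<bar> / sqrt (\<delta>\<^sub>0 / 2)) * (1 / sqrt (real n))"
      using eventually_gt_at_top[of 0]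
    proof eventually_elim
      case (elim n)
      have "norm (v n) = \<bar>\<theta>\<bar> / (sqrt (\<sigma>2 n) * sqrt (real n))"
        using \<sigma>0[of n] by (simp add: v_def real_sqrt_mult abs_mult)
      also have "\<dots> \<le> \<bar>\<theta>\<bar> / (sqrt (\<delta>\<^sub>0 / 2) * sqrt (real n))"
        using \<sigma>[of n] \<delta>\<^sub>0 elim by (intro divide_left_mono mult_right_mono mult_pos_pos) auto
      finally show ?case by simp
    qed
  qed
  \<comment> \<open>The subtracted linear term is the centring at \<open>n\<close>; it comes from
    the factor \<open>iexp (- v n * real n)\<close>.\<close>
  define e where "e = (\<lambda>n. (iexp (v n) - 1) * (of_real (X n * (1 + t n)) / (1 + of_real (t n) * iexp (v n))
      + of_real ((1 - X n) * (1 - t n)) / (1 - of_real (t n) * iexp (v n))) - \<i> * of_real (v n))"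
  have e: "(\<lambda>n. of_nat n * e n) \<longlonglongrightarrow> of_real (- \<theta>\<^sup>2 / 2)"
  proof (rule LIM_zero_cancel, rule Lim_null_comparison)
    show "(\<lambda>n. 3 / \<delta>\<^sub>0\<^sup>2 * (2 * \<theta>\<^sup>2 / \<delta>\<^sub>0) * \<bar>v n\<bar>) \<longlonglongrightarrow> 0"
      using tendsto_mult_right_zero[OF tendsto_rabs_zero[OF v0]] .
    show "\<forall>\<^sub>F n in sequentially. norm (of_nat n * e n - of_real (- \<theta>\<^sup>2 / 2))
        \<le> 3 / \<delta>\<^sub>0\<^sup>2 * (2 * \<theta>\<^sup>2 / \<delta>\<^sub>0) * \<bar>v n\<bar>"
      using eventually_gt_at_top[of 0]
    proof eventually_elim
      case (elim n)
      have nv: "real n * (v n)\<^sup>2 = \<theta>\<^sup>2 / \<sigma>2 n"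
        using elim \<sigma>0[of n] by (simp add: v_def power_divide)
      then have nvs: "real n * ((v n)\<^sup>2 * \<sigma>2 n / 2) = \<theta>\<^sup>2 / 2"
        using \<sigma>0[of n] by (simp add: field_simps)
      have "of_nat n * e n - of_real (- \<theta>\<^sup>2 / 2) = of_nat n * (e n + of_real ((v n)\<^sup>2 * \<sigma>2 n / 2))"
        using arg_cong[OF nvs, of complex_of_real] by (simp add: distrib_left)
      then have "norm (of_nat n * e n - of_real (- \<theta>\<^sup>2 / 2)) = real n * cmod (e n + of_real ((v n)\<^sup>2 * \<sigma>2 n / 2))"
        by (simp add: norm_mult)
      also have "\<dots> \<le> real n * (3 / \<delta>\<^sub>0\<^sup>2 * \<bar>v n\<bar> ^ 3)"
        unfolding e_def \<sigma>2_def
        by (intro mult_left_mono pgf_exponent_bound \<delta>\<^sub>0 t X) simp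
      also have "\<dots> = 3 / \<delta>\<^sub>0\<^sup>2 * (real n * (v n)\<^sup>2) * \<bar>v n\<bar>"
        by (simp add: power3_eq_cube power2_eq_square abs_mult_self_eq mult_ac)
      also have "\<dots> \<le> 3 / \<delta>\<^sub>0\<^sup>2 * (2 * \<theta>\<^sup>2 / \<delta>\<^sub>0) * \<bar>v n\<bar>"
      proof (intro mult_right_mono mult_left_mono)
        have "\<theta>\<^sup>2 / \<sigma>2 n \<le> \<theta>\<^sup>2 / (\<delta>\<^sub>0 / 2)"
          using \<sigma>[of n] \<delta>\<^sub>0 \<sigma>0[of n] by (intro divide_left_mono) auto
        then show "real n * (v n)\<^sup>2 \<le> 2 * \<theta>\<^sup>2 / \<delta>\<^sub>0" unfolding nv by (simp add: mult.commute)
      qed auto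
      finally show ?case .
    qed
  qed
  \<comment> \<open>The square-root prefactor equals \<open>exp (- Ln (w n) / 2)\<close>, so
    \<open>w \<longlonglongrightarrow> 1\<close> and continuity of the logarithm at 1
    suffice.\<close>
  define w where "w = (\<lambda>n. (1 - (of_real (t n))\<^sup>2 * (iexp (v n))\<^sup>2) / of_real (1 - (t n)\<^sup>2))"
  have td: "1 - (t n)\<^sup>2 \<ge> \<delta>\<^sub>0" for n
  proof -
    have "(t n)\<^sup>2 \<le> t n" using t[of n] \<delta>\<^sub>0 by (simp add: power2_eq_square mult_left_le)
    then show ?thesis using t(2)[of n] by linarith
  qed
  have td0: "1 - (t n)\<^sup>2 > 0" for n using td[of n] \<delta>\<^sub>0 by linarith
  have w: "w \<longlonglongrightarrow> 1"
  proof (rule LIM_zero_cancel, rule Lim_null_comparison)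
    show "(\<lambda>n. 2 / \<delta>\<^sub>0 * \<bar>v n\<bar>) \<longlonglongrightarrow> 0"
      using tendsto_mult_right_zero[OF tendsto_rabs_zero[OF v0]] .
    show "\<forall>\<^sub>F n in sequentially. norm (w n - 1) \<le> 2 / \<delta>\<^sub>0 * \<bar>v n\<bar>"
    proof (rule always_eventually, rule allI)
      fix n
      define u where "u = iexp (v n)"
      have "w n - 1 = (of_real (t n))\<^sup>2 * ((1 - u) * (1 + u)) / of_real (1 - (t n)\<^sup>2)"
      proof -
        have "complex_of_real (1 - (t n)\<^sup>2) \<noteq> 0" using td0[of n] unfolding of_real_eq_0_iff by simp
        from divide_self[OF this] have "w n - 1 = (1 - (of_real (t n))\<^sup>2 * u\<^sup>2 - of_real (1 - (t n)\<^sup>2)) / of_real (1 - (t n)\<^sup>2)"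
          unfolding w_def u_def[symmetric] diff_divide_distrib by (rule ssubst) (rule refl)
        also have "1 - (of_real (t n))\<^sup>2 * u\<^sup>2 - of_real (1 - (t n)\<^sup>2) = (of_real (t n))\<^sup>2 * ((1 - u) * (1 + u))"
          by (simp add: power2_eq_square algebra_simps)
        finally show ?thesis .
      qed
      then have "cmod (w n - 1) = (t n)\<^sup>2 * (cmod (u - 1) * cmod (1 + u)) / (1 - (t n)\<^sup>2)"
        using td0[of n] by (simp only: norm_divide norm_mult norm_power norm_of_real norm_minus_commute) simp
      also have "\<dots> \<le> 1 * (\<bar>v n\<bar> * 2) / \<delta>\<^sub>0"
      proof (intro frac_le mult_mono)
        show "cmod (u - 1) \<le> \<bar>v n\<bar>" unfolding u_def by (rule iexp_bounds)
        show "cmod (1 + u) \<le> 2" using norm_triangle_ineq[of 1 u] by (simp add: u_def)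
        show "(t n)\<^sup>2 \<le> 1" using td0[of n] by simp
      qed (use td[of n] \<delta>\<^sub>0 in auto)
      finally show "norm (w n - 1) \<le> 2 / \<delta>\<^sub>0 * \<bar>v n\<bar>" by (simp add: mult.commute)
    qed
  qed
  have "(\<lambda>n. exp (- Ln (w n) / 2) * exp (of_nat n * e n)) \<longlonglongrightarrow> exp (- Ln 1 / 2) * exp (of_real (- \<theta>\<^sup>2 / 2))"
    by (intro tendsto_mult tendsto_exp tendsto_divide tendsto_minus tendsto_Ln w e tendsto_const) auto
  moreover have "exp (- Ln (w n) / 2) * exp (of_nat n * e n) =
      iexp (- v n * real n) * density_pgf n (t n) (X n) (1 - X n) (iexp (v n))" for n
  proof -
    have "Re (1 - (of_real (t n))\<^sup>2 * (iexp (v n))\<^sup>2) > 0"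
      using t[of n] \<delta>\<^sub>0 by (intro Re_one_minus_square_pos) (simp add: norm_mult)
    then have "1 - (of_real (t n))\<^sup>2 * (iexp (v n))\<^sup>2 \<noteq> 0" by (metis less_irrefl zero_complex.sel(1))
    then have "Ln (w n) = Ln (1 - (of_real (t n))\<^sup>2 * (iexp (v n))\<^sup>2) - of_real (ln (1 - (t n)\<^sup>2))"
      unfolding w_def by (intro Ln_divide_of_real td0)
    then have "exp (- Ln (w n) / 2) =
       exp (of_real (ln (1 - (t n)\<^sup>2) / 2)) * exp (- Ln (1 - (of_real (t n))\<^sup>2 * (iexp (v n))\<^sup>2) / 2)"
      by (simp add: exp_add[symmetric] diff_divide_distrib)
    also have "exp (complex_of_real (ln (1 - (t n)\<^sup>2) / 2)) = of_real (sqrt (1 - (t n)\<^sup>2))"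
      unfolding exp_of_real using td0[of n] by (simp add: ln_sqrt[symmetric])
    finally have 1: "exp (- Ln (w n) / 2) =
       of_real (sqrt (1 - (t n)\<^sup>2)) * exp (- Ln (1 - (of_real (t n))\<^sup>2 * (iexp (v n))\<^sup>2) / 2)" .
    have ne: "of_nat n * e n = \<i> * of_real (- v n * real n) + of_nat n * (iexp (v n) - 1) *
      (of_real (X n * (1 + t n)) / (1 + of_real (t n) * iexp (v n))
      + of_real ((1 - X n) * (1 - t n)) / (1 - of_real (t n) * iexp (v n)))"
    proof -
      have "N * (a * b - \<i> * V) = \<i> * (- V * N) + N * a * b" for N a b V :: complex
        by (simp add: algebra_simps)
      then show ?thesis unfolding e_def of_real_mult[of "- v n"] of_real_minus of_real_of_nat_eq .
    qed
    show ?thesis unfolding 1 density_pgf_def ne exp_add by (simp only: mult_ac)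
  qed
  ultimately show ?thesis by (simp flip: exp_of_real)
qed

text \<open>\<open>M n\<close> is the law of the index, centred at \<open>n\<close> and divided by
  its asymptotic standard deviation. For \<open>n > 0\<close> the event k < n becomes the negative
  half-line, whose mass under the limit law is 1/2. Letting \<open>t\<close> and \<open>z\<close>
  depend on \<open>n\<close> is what later yields uniformity.\<close>

lemma eigenvalue_density_boundary_tendsto:
  fixes \<delta>\<^sub>0 :: real
  assumes \<delta>\<^sub>0: "0 < \<delta>\<^sub>0" "\<delta>\<^sub>0 < 1"
    and t: "\<And>n. 0 < t n" "\<And>n. t n < 1 - \<delta>\<^sub>0" and z: "\<And>n. z n \<in> ellipse_boundary (t n)"
  shows "(\<lambda>n. eigenvalue_density (elliptic_potential (t n)) n (z n)) \<longlonglongrightarrow> 1 / (2 * pi)"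
proof -
  define X where "X = (\<lambda>n. (Re (z n))\<^sup>2 / (semi_major (t n))\<^sup>2)"
  define \<sigma>2 where "\<sigma>2 = (\<lambda>n. X n * (1 - t n) / (1 + t n) + (1 - X n) * (1 + t n) / (1 - t n))"
  define A where "A = (\<lambda>n. density_weight n (t n) (z n))"
  define h where "h = (\<lambda>n k. (real k - real n) / sqrt (real n * \<sigma>2 n))"
  define M where "M = (\<lambda>n. distr (nat_distribution (A n)) borel (h n))"
  have t1: "\<bar>t n\<bar> < 1" for n using t[of n] \<delta>\<^sub>0 by simp
  have Y: "(Im (z n))\<^sup>2 / (semi_minor (t n))\<^sup>2 = 1 - X n" for n
    using z[of n] by (simp add: ellipse_boundary_def X_def)
  have Xn: "(Re (z n))\<^sup>2 / (semi_major (t n))\<^sup>2 = X n" for n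
    by (simp add: X_def)
  have X: "0 \<le> X n" "X n \<le> 1" for n
  proof -
    show "0 \<le> X n" by (simp add: X_def)
    have "0 \<le> (Im (z n))\<^sup>2 / (semi_minor (t n))\<^sup>2" by simp
    then show "X n \<le> 1" unfolding Y by simp
  qed
  have A: "A n k \<ge> 0" "A n sums 1" for n k
    unfolding A_def by (rule density_weight_nonneg[OF t1], rule density_weight_sums_1[OF t1])
  have \<sigma>0: "\<sigma>2 n > 0" for n
  proof (cases "X n = 0")
    case False
    then have "0 < X n * (1 - t n) / (1 + t n)" "0 \<le> (1 - X n) * (1 + t n) / (1 - t n)"
      using X[of n] t[of n] \<delta>\<^sub>0 by auto
    then show ?thesis by (simp add: \<sigma>2_def)
  qed (use t[of n] \<delta>\<^sub>0 in \<open>simp add: \<sigma>2_def\<close>)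
  have rd: "real_distribution (M n)" for n
  proof -
    interpret prob_space "nat_distribution (A n)" by (rule prob_space_nat_distribution[OF A])
    have "h n \<in> borel_measurable (nat_distribution (A n))" by (simp add: nat_distribution_def)
    then show ?thesis unfolding M_def by (rule real_distribution_distr)
  qed
  have "(\<lambda>n. char (M n) \<theta>) \<longlonglongrightarrow> char std_normal_distribution \<theta>" for \<theta>
  proof -
    define v where "v = (\<lambda>n. \<theta> / sqrt (real n * \<sigma>2 n))"
    have "char (M n) \<theta> = iexp (- v n * real n) * density_pgf n (t n) (X n) (1 - X n) (iexp (v n))" for n
      unfolding M_def
    proof (rule char_nat_distribution[OF A])
      have "cmod (of_real (t n) * iexp (v n)) < 1" using t1[of n] by (simp add: norm_mult)
      from sums_mult[OF density_weight_sums[OF t1 this, of n "z n"], of "iexp (- v n * real n)"]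
      have "(\<lambda>k. iexp (- v n * real n) * (of_real (A n k) * iexp (v n) ^ k)) sums
          (iexp (- v n * real n) * density_pgf n (t n) (X n) (1 - X n) (iexp (v n)))"
        unfolding A_def Y Xn .
      moreover have "iexp (- v n * real n) * (of_real (A n k) * iexp (v n) ^ k) =
          of_real (A n k) * iexp (\<theta> * h n k)" for k
      proof -
        have "\<theta> * h n k = - v n * real n + v n * real k"
          by (simp add: h_def v_def algebra_simps diff_divide_distrib)
        then have "iexp (\<theta> * h n k) = iexp (- v n * real n) * exp (of_nat k * (\<i> * of_real (v n)))"
          by (simp only: exp_add[symmetric]) (simp add: algebra_simps)
        then show ?thesis unfolding exp_of_nat_mult by (simp only: mult_ac)
      qed
      ultimately show "(\<lambda>k. of_real (A n k) * iexp (\<theta> * h n k)) sums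
          (iexp (- v n * real n) * density_pgf n (t n) (X n) (1 - X n) (iexp (v n)))" by (simp only:)
    qed
    then show ?thesis
      using density_pgf_normalised_tendsto[OF \<delta>\<^sub>0 t X, of \<theta>, folded \<sigma>2_def]
      by (simp add: char_std_normal_distribution v_def \<sigma>2_def)
  qed
  then have "weak_conv_m M std_normal_distribution"
    by (intro levy_continuity rd real_dist_normal_dist)
  moreover have "frontier {..<0::real} = {0}"
    by (auto simp: frontier_def closure_lessThan interior_open)
  ultimately have "(\<lambda>n. measure (M n) {..<0}) \<longlonglongrightarrow> measure std_normal_distribution {..<0}"
    using emeasure_std_normal_singleton_0
    by (intro weak_conv_imp_continuity_set_conv[OF rd real_dist_normal_dist]) auto
  then have "(\<lambda>n. measure (M n) {..<0} / pi) \<longlonglongrightarrow> (1 / 2) / pi"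
    unfolding measure_std_normal_lessThan_0 by (intro tendsto_divide) auto
  moreover have "\<forall>\<^sub>F n in sequentially. measure (M n) {..<0} / pi = eigenvalue_density (elliptic_potential (t n)) n (z n)"
    using eventually_gt_at_top[of 0]
  proof eventually_elim
    case (elim n)
    have "h n k < 0 \<longleftrightarrow> k < n" for k
    proof -
      have "0 < sqrt (real n * \<sigma>2 n)" using elim \<sigma>0[of n] by simp
      then show ?thesis unfolding h_def by (subst pos_divide_less_eq) auto
    qed
    then have "measure (M n) {..<0} = measure (nat_distribution (A n)) {..<n}"
      unfolding M_def by (subst measure_distr) (auto simp: nat_distribution_def intro!: arg_cong2[where f = measure])
    then show ?case
      unfolding measure_nat_distribution_lessThan[OF A] eigenvalue_density_elliptic[OF elim t1]
      by (simp add: A_def)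
  qed
  ultimately have "(\<lambda>n. eigenvalue_density (elliptic_potential (t n)) n (z n)) \<longlonglongrightarrow> (1 / 2) / pi"
    by (rule Lim_transform_eventually)
  then show ?thesis by simp
qed

text \<open>Uniform convergence is tested along sequences of parameters, almost maximal for each \<open>n\<close>.\<close>

lemma SUP_SUP_tendsto_0:
  fixes f :: "nat \<Rightarrow> 'a \<Rightarrow> 'b \<Rightarrow> real"
  assumes ne: "I \<noteq> {}" "\<And>t. t \<in> I \<Longrightarrow> S t \<noteq> {}" and nonneg: "\<And>n t z. f n t z \<ge> 0"
    and seq: "\<And>t z. (\<And>n. t n \<in> I) \<Longrightarrow> (\<And>n. z n \<in> S (t n)) \<Longrightarrow> (\<lambda>n. f n (t n) (z n)) \<longlonglongrightarrow> 0"
  shows "(\<lambda>n. SUP t\<in>I. SUP z\<in>S t. ereal (f n t z)) \<longlonglongrightarrow> 0"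
proof -
  \<comment> \<open>In the extended reals an empty supremum is minus infinity; the pair gives the
    lower bound 0 and also serves as default value of the test sequence.\<close>
  obtain t0 z0 where 0: "t0 \<in> I" "z0 \<in> S t0" using ne by blast
  have ge: "0 \<le> (SUP t\<in>I. SUP z\<in>S t. ereal (f n t z))" for n
    using 0 nonneg[of n t0 z0]
    by (intro SUP_upper2[OF 0(1)] SUP_upper2[OF 0(2)]) simp
  have le: "\<forall>\<^sub>F n in sequentially. (SUP t\<in>I. SUP z\<in>S t. ereal (f n t z)) \<le> ereal e" if e: "e > 0" for e
  proof -
    define bad where "bad = (\<lambda>n. \<exists>t\<in>I. \<exists>z\<in>S t. f n t z > e)"
    \<comment> \<open>Where the supremum exceeds \<open>e\<close>, the sequence picks a pair that
      witnesses it. Convergence along this one sequence then excludes bad indices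
      eventually.\<close>
    have "\<exists>p. fst p \<in> I \<and> snd p \<in> S (fst p) \<and> (bad n \<longrightarrow> f n (fst p) (snd p) > e)" for n
    proof (cases "bad n")
      case True
      then obtain t z where "t \<in> I" "z \<in> S t" "f n t z > e" unfolding bad_def by blast
      then show ?thesis by (intro exI[of _ "(t, z)"]) simp
    qed (use 0 in \<open>auto intro!: exI[of _ "(t0, z0)"]\<close>)
    then obtain p where p: "\<And>n. fst (p n) \<in> I" "\<And>n. snd (p n) \<in> S (fst (p n))"
      "\<And>n. bad n \<Longrightarrow> f n (fst (p n)) (snd (p n)) > e" by metis
    have "\<forall>\<^sub>F n in sequentially. f n (fst (p n)) (snd (p n)) < e"
      using seq[OF p(1,2)] e by (rule order_tendstoD)
    then show ?thesis
    proof eventually_elim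
      case (elim n)
      then have "\<not> bad n" using p(3)[of n] by auto
      then show ?case unfolding bad_def by (intro SUP_least) (auto simp: not_less)
    qed
  qed
  show ?thesis
  proof (rule order_tendstoI)
    fix a :: ereal assume "a < 0"
    then show "\<forall>\<^sub>F n in sequentially. a < (SUP t\<in>I. SUP z\<in>S t. ereal (f n t z))"
      by (intro always_eventually allI less_le_trans[OF _ ge])
  next
    fix a :: ereal assume "0 < a"
    then obtain e where e: "0 < ereal e" "ereal e < a" using ereal_dense2 by blast
    from le[of e] e(1) have "\<forall>\<^sub>F n in sequentially. (SUP t\<in>I. SUP z\<in>S t. ereal (f n t z)) \<le> ereal e" by simp
    then show "\<forall>\<^sub>F n in sequentially. (SUP t\<in>I. SUP z\<in>S t. ereal (f n t z)) < a"
      by eventually_elim (rule le_less_trans[OF _ e(2)])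
  qed
qed

section \<open>Comparison of the shifted ellipses with dilates of the ellipse\<close>

lemma semi_axes_bounds:
  assumes "0 < \<delta>\<^sub>0" "\<delta>\<^sub>0 < 1" "0 < t" "t < 1 - \<delta>\<^sub>0"
  shows "sqrt (\<delta>\<^sub>0 / (2 - \<delta>\<^sub>0)) \<le> semi_minor t" "semi_minor t \<le> semi_major t"
    "semi_major t \<le> sqrt (2 / \<delta>\<^sub>0)"
  \<comment> \<open>The minor axis decreases in \<open>t\<close>, and the first bound is its value
    at \<open>t = 1 - \<delta>\<^sub>0\<close>; this is the threshold for \<delta> in the theorem.
    The last bound is a convenient weakening of the value of the major axis there.\<close>
  unfolding semi_minor_def semi_major_def real_sqrt_le_iff
  using assms by (intro frac_le; simp)+

text \<open>The constant \<eta> is at most \<delta> / a for either semi-axis a, so a - \<delta>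
  \<le> (1 - \<eta>) a. The inner ellipse therefore lies in the dilate of the ellipse by 1 - \<eta>,
  where the quadratic form is at most (1 - \<eta>)^2 \<le> 1 - \<eta>.\<close>

lemma ellipse_minus_bound:
  assumes \<delta>\<^sub>0: "0 < \<delta>\<^sub>0" "\<delta>\<^sub>0 < 1" and t: "0 < t" "t < 1 - \<delta>\<^sub>0"
    and \<delta>: "0 < \<delta>" "\<delta> < sqrt (\<delta>\<^sub>0 / (2 - \<delta>\<^sub>0))" and z: "z \<in> ellipse_minus t \<delta>"
  shows "(Re z)\<^sup>2 / (semi_major t)\<^sup>2 + (Im z)\<^sup>2 / (semi_minor t)\<^sup>2 \<le> 1 - \<delta> / sqrt (2 / \<delta>\<^sub>0)"
proof -
  define \<eta> where "\<eta> = \<delta> / sqrt (2 / \<delta>\<^sub>0)"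
  note ab = semi_axes_bounds[OF \<delta>\<^sub>0 t]
  have \<eta>: "0 < \<eta>" "\<eta> < 1" using \<delta> ab \<delta>\<^sub>0 by (auto simp: \<eta>_def)
  have *: "x\<^sup>2 / a\<^sup>2 \<le> (1 - \<eta>)\<^sup>2 * (x\<^sup>2 / (a - \<delta>)\<^sup>2)" if "\<delta> < a" "a \<le> sqrt (2 / \<delta>\<^sub>0)" for a x
  proof -
    have "0 < sqrt (2 / \<delta>\<^sub>0)" using \<delta>\<^sub>0 by simp
    then have "\<delta> * (a / sqrt (2 / \<delta>\<^sub>0)) \<le> \<delta> * 1"
      using that(2) \<delta> by (intro mult_left_mono, subst pos_divide_le_eq) auto
    then have "\<eta> * a \<le> \<delta>" by (simp add: \<eta>_def)
    then have "a - \<delta> \<le> (1 - \<eta>) * a" by (simp add: algebra_simps)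
    then have "(a - \<delta>)\<^sup>2 \<le> ((1 - \<eta>) * a)\<^sup>2" using that by (intro power_mono) auto
    then have "x\<^sup>2 / ((1 - \<eta>) * a)\<^sup>2 \<le> x\<^sup>2 / (a - \<delta>)\<^sup>2"
      using that \<delta> \<eta> by (intro divide_left_mono) auto
    from mult_left_mono[OF this, of "(1 - \<eta>)\<^sup>2"] show ?thesis
      using \<eta> that \<delta> by (simp add: power_mult_distrib)
  qed
  have "(Re z)\<^sup>2 / (semi_major t)\<^sup>2 + (Im z)\<^sup>2 / (semi_minor t)\<^sup>2 \<le>
      (1 - \<eta>)\<^sup>2 * ((Re z)\<^sup>2 / (semi_major t - \<delta>)\<^sup>2 + (Im z)\<^sup>2 / (semi_minor t - \<delta>)\<^sup>2)"
    unfolding distrib_left using ab \<delta> by (intro add_mono *) auto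
  also have "\<dots> \<le> (1 - \<eta>)\<^sup>2 * 1"
    using z by (intro mult_left_mono) (auto simp: ellipse_minus_def)
  also have "\<dots> \<le> 1 - \<eta>" using \<eta> by (simp add: power2_eq_square mult_left_le)
  finally show ?thesis by (simp add: \<eta>_def)
qed

text \<open>With the same \<eta>, the outer ellipse contains the dilate by 1 + \<eta>, and (1 +
  \<eta>)^2 \<ge> 1 + \<eta>.\<close>

lemma ellipse_plus_bound:
  assumes \<delta>\<^sub>0: "0 < \<delta>\<^sub>0" "\<delta>\<^sub>0 < 1" and t: "0 < t" "t < 1 - \<delta>\<^sub>0"
    and \<delta>: "0 < \<delta>" and z: "z \<notin> ellipse_plus t \<delta>"
  shows "(Re z)\<^sup>2 / (semi_major t)\<^sup>2 + (Im z)\<^sup>2 / (semi_minor t)\<^sup>2 \<ge> 1 + \<delta> / sqrt (2 / \<delta>\<^sub>0)"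
proof -
  define \<eta> where "\<eta> = \<delta> / sqrt (2 / \<delta>\<^sub>0)"
  note ab = semi_axes_bounds[OF \<delta>\<^sub>0 t]
  have \<eta>: "0 < \<eta>" using \<delta> \<delta>\<^sub>0 by (auto simp: \<eta>_def)
  have b: "0 < semi_minor t" using t \<delta>\<^sub>0 by (simp add: semi_minor_def)
  have *: "(1 + \<eta>)\<^sup>2 * (x\<^sup>2 / (a + \<delta>)\<^sup>2) \<le> x\<^sup>2 / a\<^sup>2" if "0 < a" "a \<le> sqrt (2 / \<delta>\<^sub>0)" for a x
  proof -
    have "0 < sqrt (2 / \<delta>\<^sub>0)" using \<delta>\<^sub>0 by simp
    then have "\<delta> * (a / sqrt (2 / \<delta>\<^sub>0)) \<le> \<delta> * 1"
      using that(2) \<delta> by (intro mult_left_mono, subst pos_divide_le_eq) auto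
    then have "\<eta> * a \<le> \<delta>" by (simp add: \<eta>_def)
    then have "(1 + \<eta>) * a \<le> a + \<delta>" by (simp add: algebra_simps)
    then have "((1 + \<eta>) * a)\<^sup>2 \<le> (a + \<delta>)\<^sup>2" using that \<eta> by (intro power_mono) auto
    then have "x\<^sup>2 / (a + \<delta>)\<^sup>2 \<le> x\<^sup>2 / ((1 + \<eta>) * a)\<^sup>2"
      using that \<delta> \<eta> by (intro divide_left_mono) auto
    from mult_left_mono[OF this, of "(1 + \<eta>)\<^sup>2"] show ?thesis
      using \<eta> that \<delta> by (simp add: power_mult_distrib)
  qed
  have "1 + \<eta> \<le> (1 + \<eta>)\<^sup>2 * 1" using \<eta> by (simp add: power2_eq_square)
  also have "\<dots> \<le> (1 + \<eta>)\<^sup>2 * ((Re z)\<^sup>2 / (semi_major t + \<delta>)\<^sup>2 + (Im z)\<^sup>2 / (semi_minor t + \<delta>)\<^sup>2)"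
    using z by (intro mult_left_mono) (auto simp: ellipse_plus_def)
  also have "\<dots> \<le> (Re z)\<^sup>2 / (semi_major t)\<^sup>2 + (Im z)\<^sup>2 / (semi_minor t)\<^sup>2"
    unfolding distrib_left using ab b by (intro add_mono *) auto
  finally show ?thesis by (simp add: \<eta>_def)
qed

theorem proposition9p21:
  fixes \<delta>\<^sub>0 \<delta> :: real
  assumes "0 < \<delta>\<^sub>0" and "\<delta>\<^sub>0 < 1"
    and "0 < \<delta>" and "\<delta> < sqrt (\<delta>\<^sub>0 / (2 - \<delta>\<^sub>0))"
  shows "((\<lambda>n::nat. SUP t\<in>{0<..<1 - \<delta>\<^sub>0}. SUP z\<in>ellipse_minus t \<delta>.
            ereal \<bar>eigenvalue_density (elliptic_potential t) n z - 1 / pi\<bar>) \<longlonglongrightarrow> 0) \<and>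
         ((\<lambda>n::nat. SUP t\<in>{0<..<1 - \<delta>\<^sub>0}. SUP z\<in>- ellipse_plus t \<delta>.
            ereal \<bar>eigenvalue_density (elliptic_potential t) n z\<bar>) \<longlonglongrightarrow> 0) \<and>
         ((\<lambda>n::nat. SUP t\<in>{0<..<1 - \<delta>\<^sub>0}. SUP z\<in>ellipse_boundary t.
            ereal \<bar>eigenvalue_density (elliptic_potential t) n z - 1 / (2 * pi)\<bar>) \<longlonglongrightarrow> 0)"
proof -
  define \<eta> where "\<eta> = \<delta> / sqrt (2 / \<delta>\<^sub>0)"
  define q where "q = exp (- (\<eta>\<^sup>2 * \<delta>\<^sub>0 / 16))"
  have "\<delta>\<^sub>0 / (2 - \<delta>\<^sub>0) \<le> 2 / \<delta>\<^sub>0"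
    using assms(1,2) by (intro frac_le) auto
  then have "sqrt (\<delta>\<^sub>0 / (2 - \<delta>\<^sub>0)) \<le> sqrt (2 / \<delta>\<^sub>0)" by simp
  with assms(4) have "\<delta> < sqrt (2 / \<delta>\<^sub>0)" by linarith
  then have \<eta>: "0 < \<eta>" "\<eta> \<le> 1"
    using assms(1,3) by (auto simp: \<eta>_def)
  have "\<bar>q\<bar> < 1" using \<eta> assms(1) by (simp add: q_def)
  then have q: "(\<lambda>n. C * q ^ n) \<longlonglongrightarrow> 0" for C
    by (intro tendsto_mult_right_zero LIMSEQ_power_zero) simp
  have ne: "{0<..<1 - \<delta>\<^sub>0} \<noteq> {}" using assms(2) by auto
  have a0: "semi_major t > 0" if "t \<in> {0<..<1 - \<delta>\<^sub>0}" for t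
    using that assms(1) by (simp add: semi_major_def)
  show ?thesis
  proof (intro conjI)
    show "(\<lambda>n. SUP t\<in>{0<..<1 - \<delta>\<^sub>0}. SUP z\<in>ellipse_minus t \<delta>.
        ereal \<bar>eigenvalue_density (elliptic_potential t) n z - 1 / pi\<bar>) \<longlonglongrightarrow> 0"
    proof (rule SUP_SUP_tendsto_0[OF ne])
      fix t :: real
      have "0 \<in> ellipse_minus t \<delta>" by (simp add: ellipse_minus_def)
      then show "ellipse_minus t \<delta> \<noteq> {}" by blast
    next
      fix t :: "nat \<Rightarrow> real" and z :: "nat \<Rightarrow> complex"
      assume t: "\<And>n. t n \<in> {0<..<1 - \<delta>\<^sub>0}" and z: "\<And>n. z n \<in> ellipse_minus (t n) \<delta>"
      have "\<forall>\<^sub>F n in sequentially. norm \<bar>eigenvalue_density (elliptic_potential (t n)) n (z n) - 1 / pi\<bar>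
          \<le> sqrt (2 / \<delta>\<^sub>0) * q ^ n"
        using eventually_gt_at_top[of 0]
      proof eventually_elim
        case (elim n)
        have "0 < t n" "t n < 1 - \<delta>\<^sub>0" using t[of n] by auto
        from eigenvalue_density_interior_bound[OF assms(1,2) \<eta> elim this
            ellipse_minus_bound[OF assms(1,2) this assms(3,4) z, folded \<eta>_def]]
        show ?case by (simp add: q_def)
      qed
      then show "(\<lambda>n. \<bar>eigenvalue_density (elliptic_potential (t n)) n (z n) - 1 / pi\<bar>) \<longlonglongrightarrow> 0"
        by (rule Lim_null_comparison[OF _ q])
    qed simp
    show "(\<lambda>n. SUP t\<in>{0<..<1 - \<delta>\<^sub>0}. SUP z\<in>- ellipse_plus t \<delta>.
        ereal \<bar>eigenvalue_density (elliptic_potential t) n z\<bar>) \<longlonglongrightarrow> 0"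
    proof (rule SUP_SUP_tendsto_0[OF ne])
      fix t assume "t \<in> {0<..<1 - \<delta>\<^sub>0}"
      \<comment> \<open>A vertex of the outer ellipse, which the strict inequality excludes.\<close>
      then have "of_real (semi_major t + \<delta>) \<in> - ellipse_plus t \<delta>"
        using a0[of t] assms(3) by (simp add: ellipse_plus_def del: of_real_add)
      then show "- ellipse_plus t \<delta> \<noteq> {}" by blast
    next
      fix t :: "nat \<Rightarrow> real" and z :: "nat \<Rightarrow> complex"
      assume t: "\<And>n. t n \<in> {0<..<1 - \<delta>\<^sub>0}" and z: "\<And>n. z n \<in> - ellipse_plus (t n) \<delta>"
      have "\<forall>\<^sub>F n in sequentially. norm \<bar>eigenvalue_density (elliptic_potential (t n)) n (z n)\<bar> \<le> 1 * q ^ n"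
        using eventually_gt_at_top[of 0]
      proof eventually_elim
        case (elim n)
        have "0 < t n" "t n < 1 - \<delta>\<^sub>0" "z n \<notin> ellipse_plus (t n) \<delta>" using t[of n] z[of n] by auto
        from eigenvalue_density_exterior_bound[OF assms(1,2) \<eta> elim this(1,2)
            ellipse_plus_bound[OF assms(1,2) this(1,2) assms(3) this(3), folded \<eta>_def]]
        show ?case by (simp add: q_def)
      qed
      then show "(\<lambda>n. \<bar>eigenvalue_density (elliptic_potential (t n)) n (z n)\<bar>) \<longlonglongrightarrow> 0"
        by (rule Lim_null_comparison[OF _ q])
    qed simp
    show "(\<lambda>n. SUP t\<in>{0<..<1 - \<delta>\<^sub>0}. SUP z\<in>ellipse_boundary t.
        ereal \<bar>eigenvalue_density (elliptic_potential t) n z - 1 / (2 * pi)\<bar>) \<longlonglongrightarrow> 0"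
    proof (rule SUP_SUP_tendsto_0[OF ne])
      fix t assume "t \<in> {0<..<1 - \<delta>\<^sub>0}"
      then have "of_real (semi_major t) \<in> ellipse_boundary t"
        using a0[of t] by (simp add: ellipse_boundary_def)
      then show "ellipse_boundary t \<noteq> {}" by blast
    next
      fix t :: "nat \<Rightarrow> real" and z :: "nat \<Rightarrow> complex"
      assume "\<And>n. t n \<in> {0<..<1 - \<delta>\<^sub>0}" "\<And>n. z n \<in> ellipse_boundary (t n)"
      then show "(\<lambda>n. \<bar>eigenvalue_density (elliptic_potential (t n)) n (z n) - 1 / (2 * pi)\<bar>) \<longlonglongrightarrow> 0"
        by (intro tendsto_rabs_zero LIM_zero eigenvalue_density_boundary_tendsto[OF assms(1,2)]) auto
    qed simp
  qed
qed

end
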